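(* Let $(\mathcal X_n,\mathcal X_n^\Omega)$, $n\in\mathbb N$, be a sequence of standard quasi-universal spaces and $(\mathcal Z,\mathcal Z^\Omega)$ any quasi-universal space. Put $\mathcal X_{0:n}:=\prod_{k=0}^n\mathcal X_k$ and $\mathcal X_{\mathbb N}:=\prod_{n\in\mathbb N}\mathcal X_n$ (products of quasi-universal spaces), and let $\mathrm{pr}_{0:n}$ denote the canonical projections onto $\mathcal X_{0:n}$. Assume that for every $n\in\mathbb N$ we have $Q_n(X_{0:n}|Z)\in\mathsf P(\mathcal X_{0:n})^{\mathcal Z}$ such that for every $n\in\mathbb N$ $$\mathrm{pr}_{0:n,*}Q_{n+1}(X_{0:n+1}|Z)=Q_n(X_{0:n}|Z).$$ Then there exists a unique $Q(X_{\mathbb N}|Z)\in\mathsf P(\mathcal X_{\mathbb N})^{\mathcal Z}$ such that for every $n\in\mathbb N$ $$\mathrm{pr}_{0:n,*}Q(X_{\mathbb N}|Z)=Q_n(X_{0:n}|Z).$$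
   Context: Fix the sample space: $\Omega=[0,1]^{\mathbb N}$, $\mathcal B_\Omega$ the $\sigma$-algebra of all universally measurable subsets of $\Omega$, $\Omega^\Omega$ the set of all measurable maps $(\Omega,\mathcal B_\Omega)\to(\Omega,\mathcal B_\Omega)$. A quasi-universal space is a pair $(\mathcal X,\mathcal X^\Omega)$ of a set and a set $\mathcal X^\Omega$ of maps $\Omega\to\mathcal X$ (admissible random variables) containing all constants and closed under $X\mapsto X\circ\Phi$, $\Phi\in\Omega^\Omega$; $g:\mathcal X\to\mathcal Y$ is quasi-measurable if $g\circ\mathcal X^\Omega\subseteq\mathcal Y^\Omega$; arbitrary products carry the componentwise structure $\prod_i\mathcal X_i^\Omega$. For spaces $\mathcal X,\mathcal Z$, $\mathcal X^{\mathcal Z}$ is the set of quasi-measurable maps $\mathcal Z\to\mathcal X$, and $(\mathcal X^\Omega)^\Omega$ is the set of maps $X:\Omega\to\mathcal X^\Omega$ with $(\omega,\omega')\mapsto X(\omega)(\omega')$ quasi-measurable $\Omega\times\Omega\to\mathcal X$. The induced $\sigma$-algebra is $\mathcal B_{\mathcal X}=\{A\subseteq\mathcal X\mid X^{-1}(A)\in\mathcal B_\Omega\ \forall X\in\mathcal X^\Omega\}$. A quasi-universal space is standard if it is empty or a retract of $(\Omega,\Omega^\Omega)$, i.e. there are quasi-measurable $i:\mathcal X\to\Omega$, $r:\Omega\to\mathcal X$ with $r\circ i=\mathrm{id}$. $\mathsf P(\mathcal X)$ is the quasi-universal space of push-forward measures $X_*P$ on $\mathcal B_{\mathcal X}$,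 with $X\in\mathcal X^\Omega$ and $P$ a probability measure on $(\Omega,\mathcal B_\Omega)$; its admissible random variables are the maps $\omega\mapsto X(\omega)_*P$ with $X\in(\mathcal X^\Omega)^\Omega$, $P$ a probability measure on $(\Omega,\mathcal B_\Omega)$. *)

theory Defs
  imports "HOL-Probability.Probability"
begin

section \<open>Universally measurable sets and the sample space\<close>

definition universally_measurable :: "'a measure \<Rightarrow> 'a set set" where
  "universally_measurable M =
     {A. A \<subseteq> space M \<and> (\<forall>\<mu>. prob_space \<mu> \<and> sets \<mu> = sets M \<longrightarrow> A \<in> sets (completion \<mu>))}"

lemma sigma_algebra_universally_measurable:
  "sigma_algebra (space M) (universally_measurable M)"
proof -
  have sp: "space \<mu> = space M" if "sets \<mu> = sets M" for \<mu> :: "'a measure"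
    using that by (rule sets_eq_imp_space_eq)
  show ?thesis
    unfolding sigma_algebra_iff2
  proof (intro conjI ballI allI impI)
    show "universally_measurable M \<subseteq> Pow (space M)" "{} \<in> universally_measurable M"
      by (auto simp: universally_measurable_def)
  next
    fix A assume A: "A \<in> universally_measurable M"
    have "space M - A \<in> sets (completion \<mu>)" if "prob_space \<mu>" "sets \<mu> = sets M" for \<mu>
      using sets.compl_sets[of A "completion \<mu>"] A that sp[OF that(2)]
      by (auto simp: universally_measurable_def)
    then show "space M - A \<in> universally_measurable M"
      by (auto simp: universally_measurable_def)
  next
    fix A :: "nat \<Rightarrow> 'a set" assume "range A \<subseteq> universally_measurable M"
    then show "(\<Union>i. A i) \<in> universally_measurable M"
      unfolding universally_measurable_def
      by (auto intro!: sets.countable_UN)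
  qed
qed

definition Omega :: "(nat \<Rightarrow> real) set" where
  "Omega = {\<omega>. \<forall>n. \<omega> n \<in> {0..1}}"

definition Omega_M :: "(nat \<Rightarrow> real) measure" where
  "Omega_M = sigma Omega (universally_measurable (restrict_space borel Omega))"

lemma space_Omega_M [simp]: "space Omega_M = Omega"
  by (simp add: Omega_M_def space_measure_of_conv)

lemma sets_Omega_M:
  "sets Omega_M = universally_measurable (restrict_space borel Omega)"
proof -
  interpret sigma_algebra Omega "universally_measurable (restrict_space borel Omega)"
    using sigma_algebra_universally_measurable[of "restrict_space borel Omega"]
    by (simp add: space_restrict_space)
  show ?thesis
    by (simp add: Omega_M_def sets_measure_of_eq)
qed

definition Omega_probs :: "(nat \<Rightarrow> real) measure set" where
  "Omega_probs = {P. prob_space P \<and> sets P = sets Omega_M}"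


section \<open>Quasi-universal spaces\<close>

text \<open>
  All maps are represented extensionally: a map with domain \<open>A\<close> is \<open>undefined\<close> outside \<open>A\<close>,
  so that equality of maps between carriers is equality in HOL.
\<close>

record 'a qus =
  pts :: "'a set"
  adm :: "((nat \<Rightarrow> real) \<Rightarrow> 'a) set"

definition Omega_maps :: "((nat \<Rightarrow> real) \<Rightarrow> nat \<Rightarrow> real) set" where
  "Omega_maps = measurable Omega_M Omega_M \<inter> extensional Omega"

definition quasi_universal_space :: "'a qus \<Rightarrow> bool" where
  "quasi_universal_space S \<longleftrightarrow>
     adm S \<subseteq> Omega \<rightarrow>\<^sub>E pts S \<and>
     (\<forall>x\<in>pts S. (\<lambda>\<omega>\<in>Omega. x) \<in> adm S) \<and>
     (\<forall>\<alpha>\<in>adm S. \<forall>\<Phi>\<in>Omega_maps. compose Omega \<alpha> \<Phi> \<in> adm S)"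

definition quasi_measurable :: "'a qus \<Rightarrow> 'b qus \<Rightarrow> ('a \<Rightarrow> 'b) set" where
  "quasi_measurable S T =
     {g \<in> pts S \<rightarrow>\<^sub>E pts T. \<forall>\<alpha>\<in>adm S. compose Omega g \<alpha> \<in> adm T}"

definition Omega_qus :: "(nat \<Rightarrow> real) qus" where
  "Omega_qus = \<lparr>pts = Omega, adm = Omega_maps\<rparr>"

definition pair_qus :: "'a qus \<Rightarrow> 'b qus \<Rightarrow> ('a \<times> 'b) qus" where
  "pair_qus S T =
     \<lparr>pts = pts S \<times> pts T,
      adm = {\<lambda>\<omega>\<in>Omega. (\<alpha> \<omega>, \<beta> \<omega>) | \<alpha> \<beta>. \<alpha> \<in> adm S \<and> \<beta> \<in> adm T}\<rparr>"

definition prod_qus :: "'i set \<Rightarrow> ('i \<Rightarrow> 'a qus) \<Rightarrow> ('i \<Rightarrow> 'a) qus" where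
  "prod_qus I S =
     \<lparr>pts = (\<Pi>\<^sub>E i\<in>I. pts (S i)),
      adm = {\<alpha> \<in> Omega \<rightarrow>\<^sub>E (\<Pi>\<^sub>E i\<in>I. pts (S i)). \<forall>i\<in>I. (\<lambda>\<omega>\<in>Omega. \<alpha> \<omega> i) \<in> adm (S i)}\<rparr>"

definition standard_qus :: "'a qus \<Rightarrow> bool" where
  "standard_qus S \<longleftrightarrow>
     quasi_universal_space S \<and>
     (pts S = {} \<or>
      (\<exists>i\<in>quasi_measurable S Omega_qus. \<exists>r\<in>quasi_measurable Omega_qus S.
         \<forall>x\<in>pts S. r (i x) = x))"

definition induced_M :: "'a qus \<Rightarrow> 'a measure" where
  "induced_M S =
     sigma (pts S) {A. A \<subseteq> pts S \<and> (\<forall>\<alpha>\<in>adm S. \<alpha> -` A \<inter> Omega \<in> sets Omega_M)}"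

text \<open>\<open>adm S\<close> is the set of points of the exponential \<open>S\<^sup>\<Omega>\<close> (see \<open>quasi_measurable_Omega\<close> below);
  the following are its admissible random variables, in uncurried form.\<close>

definition adm_adm :: "'a qus \<Rightarrow> ((nat \<Rightarrow> real) \<Rightarrow> (nat \<Rightarrow> real) \<Rightarrow> 'a) set" where
  "adm_adm S =
     {X \<in> Omega \<rightarrow>\<^sub>E adm S.
        (\<lambda>(\<omega>, \<omega>')\<in>Omega \<times> Omega. X \<omega> \<omega>') \<in> quasi_measurable (pair_qus Omega_qus Omega_qus) S}"

definition prob_qus :: "'a qus \<Rightarrow> 'a measure qus" where
  "prob_qus S =
     \<lparr>pts = {distr P (induced_M S) X | X P. X \<in> adm S \<and> P \<in> Omega_probs},
      adm = {\<lambda>\<omega>\<in>Omega. distr P (induced_M S) (X \<omega>) | X P. X \<in> adm_adm S \<and> P \<in> Omega_probs}\<rparr>"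


section \<open>Basic facts\<close>

lemma Omega_maps_D: "\<Phi> \<in> Omega_maps \<Longrightarrow> \<omega> \<in> Omega \<Longrightarrow> \<Phi> \<omega> \<in> Omega"
  using measurable_space[of \<Phi> Omega_M Omega_M] by (auto simp: Omega_maps_def)

lemma compose_in_Omega_maps:
  assumes "\<Phi> \<in> Omega_maps" "\<Psi> \<in> Omega_maps"
  shows "compose Omega \<Phi> \<Psi> \<in> Omega_maps"
proof -
  have "\<Phi> \<circ> \<Psi> \<in> measurable Omega_M Omega_M"
    using assms by (auto simp: Omega_maps_def)
  then have "compose Omega \<Phi> \<Psi> \<in> measurable Omega_M Omega_M"
    by (subst measurable_cong[of _ _ "\<Phi> \<circ> \<Psi>"]) (auto simp: compose_def)
  then show ?thesis
    by (simp add: Omega_maps_def compose_def)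
qed

lemma id_in_Omega_maps: "(\<lambda>\<omega>\<in>Omega. \<omega>) \<in> Omega_maps"
proof -
  have "(\<lambda>\<omega>\<in>Omega. \<omega>) \<in> measurable Omega_M Omega_M"
    by (subst measurable_cong[of _ _ "\<lambda>\<omega>. \<omega>"]) auto
  then show ?thesis by (simp add: Omega_maps_def)
qed

lemma const_in_Omega_maps: "x \<in> Omega \<Longrightarrow> (\<lambda>\<omega>\<in>Omega. x) \<in> Omega_maps"
proof -
  assume "x \<in> Omega"
  then have "(\<lambda>\<omega>\<in>Omega. x) \<in> measurable Omega_M Omega_M"
    by (subst measurable_cong[of _ _ "\<lambda>\<omega>. x"]) auto
  then show ?thesis by (simp add: Omega_maps_def)
qed

lemma quasi_universal_space_Omega: "quasi_universal_space Omega_qus"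
proof -
  have "Omega_maps \<subseteq> Omega \<rightarrow>\<^sub>E Omega"
    using Omega_maps_D by (intro subsetI PiE_I) (auto simp: Omega_maps_def extensional_def)
  then show ?thesis
    by (simp add: quasi_universal_space_def Omega_qus_def const_in_Omega_maps compose_in_Omega_maps)
qed

lemma quasi_measurable_Omega:
  assumes "quasi_universal_space S"
  shows "quasi_measurable Omega_qus S = adm S"
proof (intro equalityI subsetI)
  fix g assume g: "g \<in> quasi_measurable Omega_qus S"
  then have "compose Omega g (\<lambda>\<omega>\<in>Omega. \<omega>) \<in> adm S"
    using id_in_Omega_maps by (auto simp: quasi_measurable_def Omega_qus_def)
  moreover have "compose Omega g (\<lambda>\<omega>\<in>Omega. \<omega>) = g"
    using g by (auto simp: quasi_measurable_def Omega_qus_def compose_def PiE_def extensional_def)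
  ultimately show "g \<in> adm S" by simp
qed (use assms in \<open>auto simp: quasi_measurable_def Omega_qus_def quasi_universal_space_def\<close>)

lemma quasi_universal_space_prod:
  assumes "\<And>i. i \<in> I \<Longrightarrow> quasi_universal_space (S i)"
  shows "quasi_universal_space (prod_qus I S)"
  unfolding quasi_universal_space_def
proof (intro conjI ballI)
  show "adm (prod_qus I S) \<subseteq> Omega \<rightarrow>\<^sub>E pts (prod_qus I S)"
    by (auto simp: prod_qus_def)
next
  fix x assume x: "x \<in> pts (prod_qus I S)"
  have "(\<lambda>\<omega>\<in>Omega. (\<lambda>\<omega>\<in>Omega. x) \<omega> i) = (\<lambda>\<omega>\<in>Omega. x i)" for i
    by auto
  then show "(\<lambda>\<omega>\<in>Omega. x) \<in> adm (prod_qus I S)"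
    using x assms by (auto simp: prod_qus_def quasi_universal_space_def cong: restrict_cong)
next
  fix \<alpha> \<Phi> assume \<alpha>: "\<alpha> \<in> adm (prod_qus I S)" and \<Phi>: "\<Phi> \<in> Omega_maps"
  have "(\<lambda>\<omega>\<in>Omega. compose Omega \<alpha> \<Phi> \<omega> i) = compose Omega (\<lambda>\<omega>\<in>Omega. \<alpha> \<omega> i) \<Phi>" for i
    using Omega_maps_D[OF \<Phi>] by (auto simp: compose_def)
  then have "(\<lambda>\<omega>\<in>Omega. compose Omega \<alpha> \<Phi> \<omega> i) \<in> adm (S i)" if "i \<in> I" for i
    using assms[OF that] \<alpha> \<Phi> that by (auto simp: prod_qus_def quasi_universal_space_def)
  moreover have "compose Omega \<alpha> \<Phi> \<in> Omega \<rightarrow>\<^sub>E (\<Pi>\<^sub>E i\<in>I. pts (S i))"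
    using \<alpha> Omega_maps_D[OF \<Phi>] by (auto simp: prod_qus_def compose_def)
  ultimately show "compose Omega \<alpha> \<Phi> \<in> adm (prod_qus I S)"
    by (simp add: prod_qus_def)
qed

lemma space_induced_M [simp]: "space (induced_M S) = pts S"
  by (simp add: induced_M_def space_measure_of_conv)

lemma sets_induced_M:
  assumes "quasi_universal_space S"
  shows "sets (induced_M S) = {A. A \<subseteq> pts S \<and> (\<forall>\<alpha>\<in>adm S. \<alpha> -` A \<inter> Omega \<in> sets Omega_M)}"
    (is "_ = ?B")
proof -
  have "sigma_algebra (pts S) ?B"
    unfolding sigma_algebra_iff2
  proof (intro conjI ballI allI impI)
    fix A assume A: "A \<in> ?B"
    have "\<alpha> -` (pts S - A) \<inter> Omega \<in> sets Omega_M" if "\<alpha> \<in> adm S" for \<alpha>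
    proof -
      have "\<alpha> -` (pts S - A) \<inter> Omega = space Omega_M - (\<alpha> -` A \<inter> Omega)"
        using assms that by (auto simp: quasi_universal_space_def dest!: subsetD dest: PiE_mem)
      moreover have "\<alpha> -` A \<inter> Omega \<in> sets Omega_M"
        using A that by simp
      ultimately show ?thesis
        by (simp only: sets.compl_sets)
    qed
    then show "pts S - A \<in> ?B" by auto
  next
    fix A :: "nat \<Rightarrow> 'a set" assume A: "range A \<subseteq> ?B"
    have "\<alpha> -` (\<Union>i. A i) \<inter> Omega \<in> sets Omega_M" if "\<alpha> \<in> adm S" for \<alpha>
    proof -
      have "(\<Union>i. \<alpha> -` A i \<inter> Omega) \<in> sets Omega_M"
        using A that by (intro sets.countable_UN) auto
      moreover have "\<alpha> -` (\<Union>i. A i) \<inter> Omega = (\<Union>i. \<alpha> -` A i \<inter> Omega)"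
        by blast
      ultimately show ?thesis by (simp only:)
    qed
    then show "(\<Union>i. A i) \<in> ?B"
      using A by blast
  qed auto
  then show ?thesis
    unfolding induced_M_def by (rule sigma_algebra.sets_measure_of_eq)
qed

lemma adm_measurable:
  assumes "quasi_universal_space S" "\<alpha> \<in> adm S"
  shows "\<alpha> \<in> measurable Omega_M (induced_M S)"
  using assms sets_induced_M[OF assms(1)]
  by (auto simp: measurable_def quasi_universal_space_def)

lemma adm_adm_compose:
  assumes "quasi_universal_space S" "X \<in> adm_adm S" "\<Phi> \<in> Omega_maps"
  shows "compose Omega X \<Phi> \<in> adm_adm S"
proof -
  let ?u = "\<lambda>X. (\<lambda>(\<omega>, \<omega>')\<in>Omega \<times> Omega. X \<omega> \<omega>') :: (nat \<Rightarrow> real) \<times> (nat \<Rightarrow> real) \<Rightarrow> 'a"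
  have maps: "\<beta> \<in> Omega_maps \<Longrightarrow> \<omega> \<in> Omega \<Longrightarrow> \<beta> \<omega> \<in> Omega" for \<beta> \<omega>
    by (rule Omega_maps_D)
  have X: "X \<in> Omega \<rightarrow>\<^sub>E adm S"
    and u: "?u X \<in> quasi_measurable (pair_qus Omega_qus Omega_qus) S"
    using assms(2) by (auto simp: adm_adm_def)
  have sub: "adm S \<subseteq> Omega \<rightarrow>\<^sub>E pts S"
    using assms(1) by (simp add: quasi_universal_space_def)
  have "compose Omega (?u (compose Omega X \<Phi>)) (\<lambda>\<omega>\<in>Omega. (\<beta> \<omega>, \<gamma> \<omega>)) \<in> adm S"
    if "\<beta> \<in> Omega_maps" "\<gamma> \<in> Omega_maps" for \<beta> \<gamma>
  proof -
    have "compose Omega (?u (compose Omega X \<Phi>)) (\<lambda>\<omega>\<in>Omega. (\<beta> \<omega>, \<gamma> \<omega>))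
        = compose Omega (?u X) (\<lambda>\<omega>\<in>Omega. (compose Omega \<Phi> \<beta> \<omega>, \<gamma> \<omega>))"
      using maps that assms(3) by (auto simp: compose_def fun_eq_iff)
    also have "\<dots> \<in> adm S"
      using u compose_in_Omega_maps[OF assms(3) that(1)] that(2)
      by (auto simp: quasi_measurable_def pair_qus_def Omega_qus_def)
    finally show ?thesis .
  qed
  moreover have "?u (compose Omega X \<Phi>) \<in> Omega \<times> Omega \<rightarrow>\<^sub>E pts S"
    using X sub maps[OF assms(3)] by (fastforce simp: compose_def)
  moreover have "compose Omega X \<Phi> \<in> Omega \<rightarrow>\<^sub>E adm S"
    using X maps[OF assms(3)] by (auto simp: compose_def)
  ultimately show ?thesis
    by (auto simp: adm_adm_def quasi_measurable_def pair_qus_def Omega_qus_def)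
qed

lemma quasi_universal_space_prob:
  assumes "quasi_universal_space S"
  shows "quasi_universal_space (prob_qus S)"
  unfolding quasi_universal_space_def
proof (intro conjI ballI)
  show "adm (prob_qus S) \<subseteq> Omega \<rightarrow>\<^sub>E pts (prob_qus S)"
    by (auto simp: prob_qus_def adm_adm_def intro!: exI dest: PiE_mem)
next
  fix \<mu> assume "\<mu> \<in> pts (prob_qus S)"
  then obtain X P where X: "X \<in> adm S" and P: "P \<in> Omega_probs"
    and \<mu>: "\<mu> = distr P (induced_M S) X"
    by (auto simp: prob_qus_def)
  let ?X = "\<lambda>\<omega>\<in>Omega. X"
  have XE: "X \<in> Omega \<rightarrow>\<^sub>E pts S"
    using X assms by (auto simp: quasi_universal_space_def)
  have "compose Omega (\<lambda>(\<omega>, \<omega>')\<in>Omega \<times> Omega. ?X \<omega> \<omega>') (\<lambda>\<omega>\<in>Omega. (\<beta> \<omega>, \<gamma> \<omega>)) \<in> adm S"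
    if "\<beta> \<in> Omega_maps" "\<gamma> \<in> Omega_maps" for \<beta> \<gamma>
  proof -
    have "compose Omega (\<lambda>(\<omega>, \<omega>')\<in>Omega \<times> Omega. ?X \<omega> \<omega>') (\<lambda>\<omega>\<in>Omega. (\<beta> \<omega>, \<gamma> \<omega>))
        = compose Omega X \<gamma>"
      using that Omega_maps_D by (auto simp: compose_def fun_eq_iff)
    then show ?thesis
      using assms X that by (auto simp: quasi_universal_space_def)
  qed
  moreover have "(\<lambda>(\<omega>, \<omega>')\<in>Omega \<times> Omega. ?X \<omega> \<omega>') \<in> Omega \<times> Omega \<rightarrow>\<^sub>E pts S"
    using XE by auto
  ultimately have "(\<lambda>(\<omega>, \<omega>')\<in>Omega \<times> Omega. ?X \<omega> \<omega>')
      \<in> quasi_measurable (pair_qus Omega_qus Omega_qus) S"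
    unfolding quasi_measurable_def pair_qus_def Omega_qus_def qus.simps by blast
  moreover have "?X \<in> Omega \<rightarrow>\<^sub>E adm S"
    using X by auto
  ultimately have "?X \<in> adm_adm S"
    unfolding adm_adm_def by blast
  moreover have "(\<lambda>\<omega>\<in>Omega. \<mu>) = (\<lambda>\<omega>\<in>Omega. distr P (induced_M S) (?X \<omega>))"
    by (auto simp: \<mu>)
  ultimately show "(\<lambda>\<omega>\<in>Omega. \<mu>) \<in> adm (prob_qus S)"
    using P unfolding prob_qus_def qus.simps by blast
next
  fix \<alpha> \<Phi> assume "\<alpha> \<in> adm (prob_qus S)" and \<Phi>: "\<Phi> \<in> Omega_maps"
  then obtain X P where X: "X \<in> adm_adm S" and P: "P \<in> Omega_probs"
    and \<alpha>: "\<alpha> = (\<lambda>\<omega>\<in>Omega. distr P (induced_M S) (X \<omega>))"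
    by (auto simp: prob_qus_def)
  have "compose Omega \<alpha> \<Phi> = (\<lambda>\<omega>\<in>Omega. distr P (induced_M S) (compose Omega X \<Phi> \<omega>))"
    using Omega_maps_D[OF \<Phi>] by (auto simp: \<alpha> compose_def)
  then show "compose Omega \<alpha> \<Phi> \<in> adm (prob_qus S)"
    using adm_adm_compose[OF assms X \<Phi>] P by (auto simp: prob_qus_def)
qed

end

theory Submission
  imports Defs
begin

text \<open>
  Retractions of the factors onto \<open>\<Omega>\<close> combine to measurable codes of countable products by real
  sequences. The Borel laws of the codes under the given \<open>Q n z\<close> form a projective family, so
  Kolmogorov's extension theorem yields a Borel law \<open>\<nu> z\<close> of the full code. Along an admissible random
  variable of \<open>Z\<close> this is a kernel \<open>\<kappa>\<close> which is measurable on cylinders, hence everywhere. Coding sequences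
  as single reals and taking quantile functions gives a jointly measurable \<open>F\<close> with
  \<open>F (\<omega>, \<cdot>)\<^sub>* U = \<kappa> \<omega>\<close> for one fixed uniform law \<open>U\<close>; decoding \<open>F\<close> produces the required admissible
  random variable of \<open>P(X\<^sub>\<nat>)\<close>. All identities between measures on standard spaces are checked on Borel laws
  of codes, because a probability on universally measurable sets is determined by its Borel part.
\<close>

section \<open>Universally measurable maps\<close>

text \<open>Three features of the category shape the argument. An admissible random variable of
  \<open>prob_qus S\<close> has the form \<open>\<omega> \<mapsto> X(\<omega>)\<close>, pushed
  forward from one fixed law, so a measurable family of measures still has to be randomized before
  it counts as admissible. Joint quasi-measurability on \<open>Omega \<times> Omega\<close> is
  tested only along pairs of measurable maps from \<open>Omega\<close>, not in a product
  sigma-algebra, so Fubini cannot be applied to such sets directly; the Borel pairing of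
  \<open>Omega\<close> with \<open>Omega \<times> Omega\<close> and completions replace it. Finally,
  the extension theorem wants Polish factors with their Borel sets, whereas the induced
  sigma-algebras contain, already on \<open>Omega\<close>, all universally measurable sets; hence
  the passage to codes. As \<open>Z\<close> is accessible only through its admissible random
  variables, limits are formed point by point and measurability is examined after
  composition.\<close>

abbreviation Omega_B :: "(nat \<Rightarrow> real) measure" where
  "Omega_B \<equiv> restrict_space borel Omega"

lemma space_Omega_B [simp]: "space Omega_B = Omega"
  by (simp add: space_restrict_space)

lemma zero_in_Omega: "(\<lambda>_. 0) \<in> Omega"
  by (simp add: Omega_def)

lemma measurable_into_Omega_B:
  assumes "f \<in> borel_measurable M" "\<And>x. x \<in> space M \<Longrightarrow> f x \<in> Omega"
  shows "f \<in> measurable M Omega_B"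
  using assms by (intro measurable_restrict_space2) auto

lemma sets_Omega_B_subset: "sets Omega_B \<subseteq> sets Omega_M"
  unfolding sets_Omega_M universally_measurable_def
  using sets.sets_into_space[of _ Omega_B]
  by auto

lemma sets_Omega_M_completion:
  assumes "prob_space \<mu>" "sets \<mu> = sets Omega_B" "A \<in> sets Omega_M"
  shows "A \<in> sets (completion \<mu>)"
  using assms by (auto simp: sets_Omega_M universally_measurable_def)

lemma measurable_Omega_M_I:
  assumes "\<And>\<mu>. prob_space \<mu> \<Longrightarrow> sets \<mu> = sets Omega_B \<Longrightarrow> f \<in> measurable (completion \<mu>) N"
  shows "f \<in> measurable Omega_M N"
proof -
  \<comment> \<open>The hypothesis speaks only about given probabilities. A point mass supplies one,
    from which \<open>f x \<in> space N\<close> can be read off.\<close>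
  define \<mu>0 where "\<mu>0 = return Omega_B (\<lambda>_. 0)"
  have \<mu>0: "prob_space \<mu>0" "sets \<mu>0 = sets Omega_B"
    using zero_in_Omega by (auto simp: \<mu>0_def intro!: prob_space_return)
  have sp: "space \<mu> = Omega" if "sets \<mu> = sets Omega_B" for \<mu> :: "(nat \<Rightarrow> real) measure"
    using sets_eq_imp_space_eq[OF that] by simp
  show ?thesis
  proof (rule measurableI)
    fix x assume "x \<in> space Omega_M"
    then show "f x \<in> space N"
      using measurable_space[OF assms[OF \<mu>0]] sp[OF \<mu>0(2)] by simp
  next
    fix A assume A: "A \<in> sets N"
    show "f -` A \<inter> space Omega_M \<in> sets Omega_M"
      unfolding sets_Omega_M universally_measurable_def
    proof (safe, goal_cases)
      case (2 \<mu>)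
      then show ?case
        using measurable_sets[OF assms[of \<mu>] A] sp[of \<mu>] by simp
    qed auto
  qed
qed

lemma measurable_Omega_M_completion:
  assumes "f \<in> measurable Omega_M N" "prob_space \<mu>" "sets \<mu> = sets Omega_B"
  shows "f \<in> measurable (completion \<mu>) N"
proof (rule measurableI)
  have sp: "space \<mu> = Omega" using sets_eq_imp_space_eq[OF assms(3)] by simp
  show "f x \<in> space N" if "x \<in> space (completion \<mu>)" for x
    using that sp measurable_space[OF assms(1)] by simp
  show "f -` A \<inter> space (completion \<mu>) \<in> sets (completion \<mu>)" if "A \<in> sets N" for A
    using sets_Omega_M_completion[OF assms(2,3) measurable_sets[OF assms(1) that]] sp by simp
qed

text \<open>Push a Borel probability forward along \<open>f\<close>. A universally measurable set
  lies in the completion of the image law, and \<open>f\<close> stays measurable between the two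
  completions because null sets of the image law pull back to null sets.\<close>

lemma measurable_into_Omega_M:
  assumes "f \<in> measurable Omega_M Omega_B"
  shows "f \<in> measurable Omega_M Omega_M"
proof (rule measurable_Omega_M_I)
  fix \<mu> :: "(nat \<Rightarrow> real) measure" assume \<mu>: "prob_space \<mu>" "sets \<mu> = sets Omega_B"
  define \<nu> where "\<nu> = distr (completion \<mu>) Omega_B f"
  have f: "f \<in> measurable (completion \<mu>) Omega_B"
    using measurable_Omega_M_completion[OF assms \<mu>] .
  have "prob_space (completion \<mu>)"
    using prob_space.emeasure_space_1[OF \<mu>(1)] by (intro prob_spaceI) simp
  then have \<nu>: "prob_space \<nu>" "sets \<nu> = sets Omega_B"
    using f by (auto simp: \<nu>_def intro!: prob_space.prob_space_distr)
  have f\<nu>: "f \<in> measurable (completion \<mu>) \<nu>"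
    using f by (simp add: \<nu>_def)
  have "distr (completion \<mu>) \<nu> f = \<nu>"
    unfolding \<nu>_def by (rule distr_cong) simp_all
  then have f': "f \<in> measurable (completion \<mu>) (completion \<nu>)"
    by (intro completion.measurable_completion2[OF f\<nu>]) simp
  have sp: "space (completion \<nu>) = Omega"
    using sets_eq_imp_space_eq[OF \<nu>(2)] by simp
  show "f \<in> measurable (completion \<mu>) Omega_M"
  proof (rule measurableI)
    show "f x \<in> space Omega_M" if "x \<in> space (completion \<mu>)" for x
      using measurable_space[OF f' that] sp by simp
    show "f -` A \<inter> space (completion \<mu>) \<in> sets (completion \<mu>)" if "A \<in> sets Omega_M" for A
      using measurable_sets[OF f' sets_Omega_M_completion[OF \<nu> that]] .
  qed
qed

lemma measurable_Omega_M_borel: 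
  "f \<in> measurable M Omega_M \<Longrightarrow> f \<in> borel_measurable M"
proof -
  assume f: "f \<in> measurable M Omega_M"
  have "(\<lambda>\<omega>. \<omega>) \<in> measurable Omega_M Omega_B"
    using sets_Omega_B_subset by (auto simp: measurable_def)
  then have "(\<lambda>\<omega>. \<omega>) \<in> borel_measurable Omega_M"
    by (simp add: measurable_restrict_space2_iff)
  from measurable_compose[OF f this] show ?thesis .
qed

lemma measurable_Omega_M_iff:
  "f \<in> measurable Omega_M Omega_M \<longleftrightarrow> f \<in> borel_measurable Omega_M \<and> f \<in> Omega \<rightarrow> Omega"
proof safe
  assume f: "f \<in> measurable Omega_M Omega_M"
  show "f \<in> borel_measurable Omega_M"
    using f by (rule measurable_Omega_M_borel)
  show "f x \<in> Omega" if "x \<in> Omega" for x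
    using measurable_space[OF f] that by simp
next
  assume "f \<in> borel_measurable Omega_M" "f \<in> Omega \<rightarrow> Omega"
  then show "f \<in> measurable Omega_M Omega_M"
    by (intro measurable_into_Omega_M measurable_into_Omega_B) auto
qed

text \<open>The completion of the Borel part of \<open>P\<close> sandwiches \<open>A\<close> between
  \<open>S\<close> and \<open>S \<union> N'\<close> with \<open>N'\<close> Borel and
  \<open>P\<close>-null. Agreement on Borel sets makes \<open>N'\<close> null for \<open>R\<close>
  too, so both measures give \<open>A\<close> the mass of \<open>S\<close>.\<close>

lemma Omega_probs_eqI:
  assumes P: "P \<in> Omega_probs" and R: "R \<in> Omega_probs"
    and eq: "\<And>A. A \<in> sets Omega_B \<Longrightarrow> emeasure P A = emeasure R A"
  shows "P = R"
proof (rule measure_eqI)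
  have P': "prob_space P" "sets P = sets Omega_M" and R': "prob_space R" "sets R = sets Omega_M"
    using P R by (auto simp: Omega_probs_def)
  show "sets P = sets R" using P' R' by simp
  have spP: "space P = Omega" using sets_eq_imp_space_eq[OF P'(2)] by simp
  have m: "(\<lambda>x. x) \<in> measurable P Omega_B"
    using sets_Omega_B_subset P'(2) spP by (auto simp: measurable_def)
  define \<mu> where "\<mu> = distr P Omega_B (\<lambda>x. x)"
  have \<mu>: "prob_space \<mu>" "sets \<mu> = sets Omega_B"
    using m P'(1) by (auto simp: \<mu>_def intro!: prob_space.prob_space_distr)
  have e\<mu>: "emeasure \<mu> A = emeasure P A" if "A \<in> sets Omega_B" for A
    using m that sets.sets_into_space[OF that] spP by (simp add: \<mu>_def emeasure_distr Int_absorb2)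
  fix A assume A: "A \<in> sets P"
  then have A': "A \<in> sets Omega_M" using P' by simp
  obtain S N N' where SN: "A = S \<union> N" "N \<subseteq> N'" "N' \<in> null_sets \<mu>" "S \<in> sets \<mu>"
    using sets_Omega_M_completion[OF \<mu> A'] by (rule sets_completionE)
  have S: "S \<in> sets Omega_B" "N' \<in> sets Omega_B" "emeasure P N' = 0"
    using SN \<mu> e\<mu>[of N'] by (auto simp: null_sets_def)
  have "emeasure T A = emeasure T S" if T: "sets T = sets Omega_M" "emeasure T N' = 0" for T
  proof (rule antisym)
    have in_T: "S \<in> sets T" "N' \<in> sets T" "A \<in> sets T"
      using S A' T sets_Omega_B_subset by auto
    then have "emeasure T A \<le> emeasure T (S \<union> N')"
      using SN by (intro emeasure_mono) auto
    also have "\<dots> \<le> emeasure T S + emeasure T N'"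
      using in_T by (intro emeasure_subadditive)
    finally show "emeasure T A \<le> emeasure T S" using T by simp
    show "emeasure T S \<le> emeasure T A"
      using in_T SN by (intro emeasure_mono) auto
  qed
  from this[of P] this[of R] show "emeasure P A = emeasure R A"
    using P' R' S eq by simp
qed

text \<open>A countable product of copies of \<open>[0,1]\<close> splits into its even and odd coordinates; this Borel
  isomorphism \<open>\<Omega> \<cong> \<Omega> \<times> \<Omega>\<close> turns quasi-measurable subsets of \<open>\<Omega> \<times> \<Omega>\<close> into universally measurable
  subsets of \<open>\<Omega>\<close>.\<close>

definition Omega_split :: "(nat \<Rightarrow> real) \<Rightarrow> (nat \<Rightarrow> real) \<times> (nat \<Rightarrow> real)" where
  "Omega_split y = (\<lambda>n. y (2 * n), \<lambda>n. y (Suc (2 * n)))"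

definition Omega_join :: "(nat \<Rightarrow> real) \<times> (nat \<Rightarrow> real) \<Rightarrow> nat \<Rightarrow> real" where
  "Omega_join p n = (if even n then fst p (n div 2) else snd p (n div 2))"

lemma Omega_split_join: "Omega_split (Omega_join p) = p"
  by (cases p) (auto simp: Omega_split_def Omega_join_def)

lemma measurable_coord: "(\<lambda>y::nat \<Rightarrow> real. y n) \<in> borel_measurable borel"
proof -
  have "(\<lambda>y::nat \<Rightarrow> real. y n) \<in> borel_measurable (PiM UNIV (\<lambda>_. borel))"
    by simp
  then show ?thesis
    by (simp add: sets_PiM_equal_borel cong: measurable_cong_sets)
qed

lemma measurable_fun_borel:
  fixes f :: "'b \<Rightarrow> nat \<Rightarrow> real"
  shows "f \<in> borel_measurable M \<longleftrightarrow> (\<forall>n. (\<lambda>x. f x n) \<in> borel_measurable M)"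
proof
  assume "f \<in> borel_measurable M"
  from measurable_compose[OF this measurable_coord]
  show "\<forall>n. (\<lambda>x. f x n) \<in> borel_measurable M" by auto
next
  assume "\<forall>n. (\<lambda>x. f x n) \<in> borel_measurable M"
  then have "f \<in> measurable M (PiM UNIV (\<lambda>_. borel))"
    by (intro measurable_PiM_single') (auto simp: PiE_def)
  then show "f \<in> borel_measurable M"
    by (simp add: sets_PiM_equal_borel cong: measurable_cong_sets)
qed

lemma measurable_coord_Omega_M: "(\<lambda>y. y n) \<in> borel_measurable Omega_M"
  using measurable_Omega_M_borel[of "\<lambda>x. x" Omega_M] by (simp add: measurable_fun_borel)

text \<open>Universal measurability is tested against one Borel probability \<open>\<mu>\<close> at a time: \<open>C\<close> is sandwiched
  between Borel sets modulo a null set of \<open>\<mu> \<otimes> P\<close>, and \<open>\<mu>\<close>-almost all sections of that null set are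
  \<open>P\<close>-null.\<close>

lemma measurable_section_prob:
  assumes P: "P \<in> Omega_probs"
    and C: "\<And>\<beta> \<gamma>. \<beta> \<in> measurable Omega_M Omega_M \<Longrightarrow> \<gamma> \<in> measurable Omega_M Omega_M \<Longrightarrow>
              {\<omega>\<in>Omega. (\<beta> \<omega>, \<gamma> \<omega>) \<in> C} \<in> sets Omega_M"
  shows "(\<lambda>\<omega>. emeasure P {\<omega>'\<in>Omega. (\<omega>, \<omega>') \<in> C}) \<in> borel_measurable Omega_M"
proof (rule measurable_Omega_M_I)
  have P': "prob_space P" "sets P = sets Omega_M"
    using P by (auto simp: Omega_probs_def)
  have spP: "space P = Omega" using sets_eq_imp_space_eq[OF P'(2)] by simp
  have idP: "(\<lambda>x. x) \<in> measurable P Omega_B"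
    using sets_Omega_B_subset P'(2) spP by (auto simp: measurable_def)
  define P1 where "P1 = distr P Omega_B (\<lambda>x. x)"
  have P1: "prob_space P1" "sets P1 = sets Omega_B"
    using idP P'(1) by (auto simp: P1_def intro!: prob_space.prob_space_distr)
  have eP1: "emeasure P1 A = emeasure P A" if "A \<in> sets Omega_B" for A
    using idP that sets.sets_into_space[OF that] spP by (simp add: P1_def emeasure_distr Int_absorb2)
  fix \<mu> :: "(nat \<Rightarrow> real) measure" assume \<mu>: "prob_space \<mu>" "sets \<mu> = sets Omega_B"
  interpret P1: prob_space P1 by fact
  interpret \<mu>: prob_space \<mu> by fact
  interpret pair_prob_space \<mu> P1 ..
  have sp: "space \<mu> = Omega" "space P1 = Omega"
    using sets_eq_imp_space_eq[OF \<mu>(2)] sets_eq_imp_space_eq[OF P1(2)] by auto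
  have join: "Omega_join p \<in> Omega" if "p \<in> Omega \<times> Omega" for p
    using that by (auto simp: Omega_join_def Omega_def)
  have idB: "(\<lambda>y. y) \<in> borel_measurable Omega_B"
    by (rule measurable_restrict_space1) simp
  have id\<mu>: "(\<lambda>y. y) \<in> borel_measurable \<mu>" "(\<lambda>y. y) \<in> borel_measurable P1"
    using idB by (simp_all add: \<mu>(2) P1(2) cong: measurable_cong_sets)
  have joinm: "Omega_join \<in> measurable (\<mu> \<Otimes>\<^sub>M P1) Omega_B"
  proof (rule measurable_into_Omega_B)
    have 1: "fst \<in> borel_measurable (\<mu> \<Otimes>\<^sub>M P1)" "snd \<in> borel_measurable (\<mu> \<Otimes>\<^sub>M P1)"
      using measurable_compose[OF measurable_fst id\<mu>(1)] measurable_compose[OF measurable_snd id\<mu>(2)] by auto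
    have "(\<lambda>p. Omega_join p n) \<in> borel_measurable (\<mu> \<Otimes>\<^sub>M P1)" for n
      using measurable_compose[OF 1(1) measurable_coord] measurable_compose[OF 1(2) measurable_coord]
      by (cases "even n") (auto simp: Omega_join_def)
    then show "Omega_join \<in> borel_measurable (\<mu> \<Otimes>\<^sub>M P1)"
      by (simp add: measurable_fun_borel)
  qed (use join in \<open>auto simp: space_pair_measure sp\<close>)
  define \<kappa> where "\<kappa> = distr (\<mu> \<Otimes>\<^sub>M P1) Omega_B Omega_join"
  have \<kappa>: "prob_space \<kappa>" "sets \<kappa> = sets Omega_B"
    using joinm by (auto simp: \<kappa>_def intro!: prob_space_distr)
  \<comment> \<open>The two halves of \<open>Omega_split\<close> serve as \<beta> and \<gamma> in
    the hypothesis on \<open>C\<close>. This turns \<open>C\<close> into a universally measurable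
    set \<open>D\<close>, to which the completion of \<kappa> applies.\<close>
  define D where "D = {y\<in>Omega. Omega_split y \<in> C}"
  have splitm: "(\<lambda>y. fst (Omega_split y)) \<in> measurable Omega_M Omega_M"
    "(\<lambda>y. snd (Omega_split y)) \<in> measurable Omega_M Omega_M"
    by (auto simp: measurable_Omega_M_iff measurable_fun_borel Omega_split_def Omega_def
        intro: measurable_coord_Omega_M)
  have "D \<in> sets Omega_M"
    using C[OF splitm] by (simp add: D_def)
  then obtain S N N' where SN: "D = S \<union> N" "N \<subseteq> N'" "N' \<in> null_sets \<kappa>" "S \<in> sets \<kappa>"
    by (meson sets_Omega_M_completion[OF \<kappa>] sets_completionE)
  have SB: "S \<in> sets Omega_B" "N' \<in> sets Omega_B"
    using SN \<kappa> by auto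
  have sec: "{\<omega>'\<in>Omega. Omega_join (\<omega>, \<omega>') \<in> T} \<in> sets P1"
       "(\<lambda>\<omega>. emeasure P1 {\<omega>'\<in>Omega. Omega_join (\<omega>, \<omega>') \<in> T}) \<in> borel_measurable \<mu>"
    if T: "T \<in> sets Omega_B" and \<omega>: "\<omega> \<in> Omega" for T \<omega>
  proof -
    define E where "E = Omega_join -` T \<inter> space (\<mu> \<Otimes>\<^sub>M P1)"
    have E: "E \<in> sets (\<mu> \<Otimes>\<^sub>M P1)"
      using joinm T unfolding E_def by (rule measurable_sets)
    have *: "Pair \<omega> -` E = {\<omega>'\<in>Omega. Omega_join (\<omega>, \<omega>') \<in> T}" if "\<omega> \<in> Omega" for \<omega>
      using that by (auto simp: E_def space_pair_measure sp)
    show "{\<omega>'\<in>Omega. Omega_join (\<omega>, \<omega>') \<in> T} \<in> sets P1"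
      using sets_Pair1[OF E, of \<omega>] *[OF \<omega>] by simp
    have "(\<lambda>\<omega>. emeasure P1 (Pair \<omega> -` E)) \<in> borel_measurable \<mu>"
      using E by (rule P1.measurable_emeasure_Pair)
    then show "(\<lambda>\<omega>. emeasure P1 {\<omega>'\<in>Omega. Omega_join (\<omega>, \<omega>') \<in> T}) \<in> borel_measurable \<mu>"
      by (rule measurable_cong[THEN iffD1, rotated]) (simp add: * sp)
  qed
  have "emeasure (\<mu> \<Otimes>\<^sub>M P1) (Omega_join -` N' \<inter> space (\<mu> \<Otimes>\<^sub>M P1)) = 0"
    using SN(3) joinm SB(2) by (auto simp: \<kappa>_def emeasure_distr null_sets_def)
  then have "(\<integral>\<^sup>+\<omega>. emeasure P1 (Pair \<omega> -` (Omega_join -` N' \<inter> space (\<mu> \<Otimes>\<^sub>M P1))) \<partial>\<mu>) = 0"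
    using measurable_sets[OF joinm SB(2)] by (simp add: P1.emeasure_pair_measure_alt)
  then have "AE \<omega> in \<mu>. emeasure P1 (Pair \<omega> -` (Omega_join -` N' \<inter> space (\<mu> \<Otimes>\<^sub>M P1))) = 0"
    by (simp only: nn_integral_0_iff_AE[OF P1.measurable_emeasure_Pair[OF measurable_sets[OF joinm SB(2)]]])
  moreover have "AE \<omega> in \<mu>. \<omega> \<in> Omega"
    using AE_space[of \<mu>] sp by simp
  ultimately have ae: "AE \<omega> in \<mu>. emeasure P1 {\<omega>'\<in>Omega. Omega_join (\<omega>, \<omega>') \<in> S}
      = emeasure P {\<omega>'\<in>Omega. (\<omega>, \<omega>') \<in> C}"
  proof eventually_elim
    case (elim \<omega>)
    have Cw: "{\<omega>'\<in>Omega. (\<omega>, \<omega>') \<in> C} = {\<omega>'\<in>Omega. Omega_join (\<omega>, \<omega>') \<in> D}"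
      using elim(2) join by (auto simp: D_def Omega_split_join)
    let ?S = "{\<omega>'\<in>Omega. Omega_join (\<omega>, \<omega>') \<in> S}" and ?N = "{\<omega>'\<in>Omega. Omega_join (\<omega>, \<omega>') \<in> N'}"
    have s: "?S \<in> sets Omega_B" "?N \<in> sets Omega_B"
      using sec(1)[OF SB(1) elim(2)] sec(1)[OF SB(2) elim(2)] P1 by auto
    \<comment> \<open>A single section is the case of the hypothesis with \<beta> constant and
      \<gamma> the identity.\<close>
    have "{\<omega>'\<in>Omega. (\<omega>, \<omega>') \<in> C} \<in> sets Omega_M"
      using elim(2) by (intro C measurable_const measurable_ident_sets) simp_all
    then have sP: "?S \<in> sets P" "?N \<in> sets P" "{\<omega>'\<in>Omega. (\<omega>, \<omega>') \<in> C} \<in> sets P"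
      using subsetD[OF sets_Omega_B_subset s(1)] subsetD[OF sets_Omega_B_subset s(2)] by (simp_all only: P'(2))
    have "Pair \<omega> -` (Omega_join -` N' \<inter> space (\<mu> \<Otimes>\<^sub>M P1)) = ?N"
      using elim(2) by (auto simp: space_pair_measure sp)
    then have N0: "emeasure P ?N = 0"
      using elim(1) eP1[OF s(2)] by simp
    have "emeasure P {\<omega>'\<in>Omega. (\<omega>, \<omega>') \<in> C} \<le> emeasure P (?S \<union> ?N)"
      using sP SN(1,2) by (intro emeasure_mono) (auto simp: Cw)
    also have "\<dots> \<le> emeasure P ?S + emeasure P ?N"
      using sP by (intro emeasure_subadditive)
    finally have "emeasure P {\<omega>'\<in>Omega. (\<omega>, \<omega>') \<in> C} \<le> emeasure P ?S" using N0 by simp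
    moreover have "emeasure P ?S \<le> emeasure P {\<omega>'\<in>Omega. (\<omega>, \<omega>') \<in> C}"
      using sP SN(1) by (intro emeasure_mono) (auto simp: Cw)
    ultimately show ?case
      using eP1[OF s(1)] by simp
  qed
  let ?g = "\<lambda>\<omega>. emeasure P {\<omega>'\<in>Omega. (\<omega>, \<omega>') \<in> C}" 
  let ?g1 = "\<lambda>\<omega>. emeasure P1 {\<omega>'\<in>Omega. Omega_join (\<omega>, \<omega>') \<in> S}" 
  have g1: "?g1 \<in> borel_measurable \<mu>"
    using sec(2)[OF SB(1) zero_in_Omega] .
  show "?g \<in> borel_measurable (completion \<mu>)"
  proof (rule measurableI)
    fix B :: "ennreal set" assume B: "B \<in> sets borel"
    show "?g -` B \<inter> space (completion \<mu>) \<in> sets (completion \<mu>)"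
    proof (rule completion.in_sets_AE)
      show "?g1 -` B \<inter> space \<mu> \<in> sets (completion \<mu>)"
        using measurable_sets[OF g1 B] by simp
      show "AE x in completion \<mu>. x \<in> ?g1 -` B \<inter> space \<mu> \<longleftrightarrow> x \<in> ?g -` B \<inter> space (completion \<mu>)"
        using AE_completion[OF ae] by eventually_elim simp
    qed auto
  qed simp
qed

section \<open>Randomization of Borel kernels\<close>

text \<open>Bit \<open>(j, l)\<close> of \<open>y\<close> records whether \<open>y j\<close> lies below the \<open>l\<close>-th rational, so that \<open>y j\<close> is the
  infimum of the rationals above it. The bits are packed into one real as base-3 digits 0 and 2, which
  makes every digit readable by comparison with 1/2.\<close>

definition cut_point :: "nat \<Rightarrow> real" where
  "cut_point l = min 1 (max 0 (of_rat (from_nat l)))"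

definition omega_bit :: "(nat \<Rightarrow> real) \<Rightarrow> nat \<Rightarrow> bool" where
  "omega_bit y m = (y (fst (prod_decode m)) < of_rat (from_nat (snd (prod_decode m))))"

text \<open>The value 1 for a bit that is off is neutral, since no cut point exceeds it. The infimum
  thus runs over a fixed countable index set, which keeps it bounded and its measurability a matter
  of one digit at a time.\<close>

definition omega_of_bits :: "(nat \<Rightarrow> bool) \<Rightarrow> nat \<Rightarrow> real" where
  "omega_of_bits b j = (INF l. if b (prod_encode (j, l)) then cut_point l else 1)"

text \<open>The decoder returns only sequences in \<open>Omega\<close>, so decoding after encoding
  yields this retraction instead of the identity.\<close>

definition clip :: "(nat \<Rightarrow> real) \<Rightarrow> nat \<Rightarrow> real" where
  "clip y j = min 1 (max 0 (y j))"

lemma clip_id: "y \<in> Omega \<Longrightarrow> clip y = y"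
  by (auto simp: clip_def Omega_def fun_eq_iff min_def max_def intro: antisym)

lemma measurable_clip: "clip \<in> borel_measurable borel"
  using measurable_coord by (simp add: measurable_fun_borel clip_def)

lemma cut_point_bounds: "0 \<le> cut_point l" "cut_point l \<le> 1"
  by (auto simp: cut_point_def)

lemma bdd_below_omega_of_bits:
  "bdd_below (range (\<lambda>l. if b (prod_encode (j, l)) then cut_point l else 1))"
  using cut_point_bounds by (intro bdd_belowI[of _ 0]) auto

lemma omega_of_bits_in_Omega: "omega_of_bits b \<in> Omega"
proof -
  have "0 \<le> omega_of_bits b j" for j
    unfolding omega_of_bits_def using cut_point_bounds by (intro cINF_greatest) auto
  moreover have "omega_of_bits b j \<le> 1" for j
    unfolding omega_of_bits_def
    by (rule cINF_lower2[OF bdd_below_omega_of_bits, of 0]) (auto simp: cut_point_bounds)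
  ultimately show ?thesis by (auto simp: Omega_def)
qed

text \<open>Clamping to \<open>[0,1]\<close> is monotone, so every rational above \<open>y j\<close>
  gives a cut point not below \<open>clip y j\<close>. By density some such rational lies within
  \<open>e\<close> of \<open>y j\<close>, which gives the other inequality.\<close>

lemma omega_of_bits_omega_bit: "omega_of_bits (omega_bit y) = clip y"
proof
  fix j
  let ?f = "\<lambda>l. if omega_bit y (prod_encode (j, l)) then cut_point l else 1"
  have "omega_of_bits (omega_bit y) j \<le> clip y j + e" if e: "e > 0" for e
  proof -
    obtain q where q: "y j < of_rat q" "of_rat q < y j + e"
      using of_rat_dense[of "y j" "y j + e"] e by auto
    have "omega_of_bits (omega_bit y) j \<le> cut_point (to_nat q)"
      unfolding omega_of_bits_def using q(1)
      by (intro cINF_lower2[OF bdd_below_omega_of_bits, of "to_nat q"]) (auto simp: omega_bit_def)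
    also have "\<dots> \<le> clip y j + e"
      using q by (auto simp: cut_point_def clip_def)
    finally show ?thesis .
  qed
  then have "omega_of_bits (omega_bit y) j \<le> clip y j"
    by (rule field_le_epsilon)
  moreover have "clip y j \<le> omega_of_bits (omega_bit y) j"
    unfolding omega_of_bits_def
    by (intro cINF_greatest) (auto simp: omega_bit_def clip_def cut_point_def)
  ultimately show "omega_of_bits (omega_bit y) j = clip y j" by simp
qed

section \<open>Bit sequences as points of the middle-thirds Cantor set\<close>

definition ternary :: "(nat \<Rightarrow> bool) \<Rightarrow> real" where
  "ternary b = (\<Sum>k. (if b k then 2 else 0) / 3 ^ Suc k)"

text \<open>The expanding map of the Cantor set, with branches \<open>3 * x\<close> and
  \<open>3 * x - 2\<close>; on ternary codes it deletes the leading digit.\<close>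

definition ternary_shift :: "real \<Rightarrow> real" where
  "ternary_shift x = (if x \<ge> 1/2 then 3 * x - 2 else 3 * x)"

lemma ternary_sums: "(\<lambda>k. 2 / 3 ^ Suc k :: real) sums 1"
proof -
  have "(\<lambda>k. (2/3) * (1/3) ^ k :: real) sums ((2/3) * (1 / (1 - 1/3)))"
    by (intro sums_mult geometric_sums) simp
  then show ?thesis by (simp add: power_divide field_simps)
qed

lemma ternary_summable: "summable (\<lambda>k. (if b k then 2 else 0) / 3 ^ Suc k :: real)"
  by (rule summable_comparison_test'[OF sums_summable[OF ternary_sums], of 0]) auto

lemma ternary_bounds: "0 \<le> ternary b" "ternary b \<le> 1"
proof -
  show "0 \<le> ternary b"
    unfolding ternary_def by (intro suminf_nonneg ternary_summable) auto
  have "ternary b \<le> (\<Sum>k. 2 / 3 ^ Suc k)"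
    unfolding ternary_def
    by (intro suminf_le ternary_summable sums_summable[OF ternary_sums]) (auto simp: divide_right_mono)
  then show "ternary b \<le> 1"
    using sums_unique[OF ternary_sums] by simp
qed

lemma ternary_rec: "ternary b = (if b 0 then 2/3 else 0) + ternary (\<lambda>k. b (Suc k)) / 3"
proof -
  have "ternary b = (if b 0 then 2/3 else 0) + (\<Sum>k. (if b (Suc k) then 2 else 0) / 3 ^ Suc (Suc k))"
    unfolding ternary_def by (subst suminf_split_head[OF ternary_summable]) simp
  also have "(\<Sum>k. (if b (Suc k) then 2 else 0) / 3 ^ Suc (Suc k)) = ternary (\<lambda>k. b (Suc k)) / 3"
    unfolding ternary_def
    using suminf_divide[OF ternary_summable[of "\<lambda>k. b (Suc k)"], of 3] by (simp add: field_simps)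
  finally show ?thesis .
qed

text \<open>A leading digit 0 leaves at most 1/3 and a leading digit 2 gives at least 2/3, so 1/2
  lies in the gap between the two cases.\<close>

lemma ternary_digit: "b 0 \<longleftrightarrow> ternary b \<ge> 1/2"
  using ternary_bounds[of "\<lambda>k. b (Suc k)"] by (subst ternary_rec) auto

lemma ternary_shift_ternary: "ternary_shift (ternary b) = ternary (\<lambda>k. b (Suc k))"
proof -
  have "ternary_shift (ternary b) = (if b 0 then 3 * ternary b - 2 else 3 * ternary b)"
    by (simp add: ternary_shift_def ternary_digit)
  then show ?thesis
    using ternary_rec[of b] by simp
qed

lemma ternary_shift_funpow: "(ternary_shift ^^ m) (ternary b) = ternary (\<lambda>k. b (m + k))"
  by (induction m) (simp_all add: ternary_shift_ternary)

definition real_encode :: "(nat \<Rightarrow> real) \<Rightarrow> real" where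
  "real_encode y = ternary (omega_bit y)"

definition real_decode :: "real \<Rightarrow> nat \<Rightarrow> real" where
  "real_decode x = omega_of_bits (\<lambda>m. (ternary_shift ^^ m) x \<ge> 1/2)"

lemma real_decode_encode: "real_decode (real_encode y) = clip y"
proof -
  have "((ternary_shift ^^ m) (real_encode y) \<ge> 1/2) = omega_bit y m" for m
    using ternary_digit[of "\<lambda>k. omega_bit y (m + k)"]
    by (simp add: real_encode_def ternary_shift_funpow)
  then show ?thesis
    by (simp add: real_decode_def omega_of_bits_omega_bit)
qed

lemma measurable_real_encode: "real_encode \<in> borel_measurable borel"
proof -
  have [measurable]: "(\<lambda>y::nat \<Rightarrow> real. y n) \<in> borel_measurable borel" for n
    by (rule measurable_coord)
  show ?thesis
    unfolding real_encode_def ternary_def omega_bit_def by measurable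
qed

lemma measurable_real_decode: "real_decode \<in> borel_measurable borel"
proof -
  have [measurable]: "ternary_shift \<in> borel_measurable borel"
    unfolding ternary_shift_def by measurable
  have [measurable]: "(ternary_shift ^^ m) \<in> borel_measurable borel" for m
  proof (induction m)
    case (Suc m)
    from measurable_compose[OF this \<open>ternary_shift \<in> _\<close>] show ?case
      by (simp add: comp_def)
  qed (simp add: id_def)
  have "(\<lambda>x. if (ternary_shift ^^ m) x \<ge> 1/2 then c else 1) \<in> borel_measurable borel" for m and c :: real
    by measurable
  then have "(\<lambda>x. real_decode x j) \<in> borel_measurable borel" for j
    unfolding real_decode_def omega_of_bits_def
    by (intro borel_measurable_cINF bdd_below_omega_of_bits) auto
  then show ?thesis by (simp add: measurable_fun_borel)
qed

text \<open>Off the open unit interval the infimum would be a junk value, so it is replaced by 0.\<close>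

definition quantile :: "real measure \<Rightarrow> real \<Rightarrow> real" where
  "quantile M u = (if u \<in> {0<..<1} then Inf {x. u \<le> cdf M x} else 0)"

text \<open>Inverse transform sampling: on the open unit interval \<open>quantile M\<close> is the
  library's pseudoinverse \<open>I\<close> of the distribution function.\<close>

lemma distr_quantile:
  assumes "real_distribution M"
  shows "distr (restrict_space lborel {0<..<1}) borel (quantile M) = M"
proof -
  interpret cdf_distribution M
    using assms by (simp add: cdf_distribution_def)
  have "distr (restrict_space lborel {0<..<1}) borel (quantile M)
      = distr (restrict_space lborel {0<..<1}) borel I"
    by (rule distr_cong) (auto simp: quantile_def space_restrict_space)
  then show ?thesis by (simp add: distr_I_eq_M)
qed

text \<open>By the Galois connection between a distribution function and its pseudoinverse,
  \<open>quantile M u \<le> a\<close> means \<open>u \<le> cdf M a\<close> for \<open>u\<close> in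
  the open unit interval. Sublevel sets thus compare two measurable functions, which handles the
  measure and the argument jointly.\<close>

lemma measurable_quantile:
  assumes K: "K \<in> measurable N (prob_algebra borel)" and f: "f \<in> borel_measurable N"
  shows "(\<lambda>x. quantile (K x) (f x)) \<in> borel_measurable N"
  unfolding borel_measurable_iff_le
proof
  fix a :: real
  note [measurable] = f
  have [measurable]: "(\<lambda>x. cdf (K x) a) \<in> borel_measurable N"
    unfolding cdf_def
    by (rule measurable_compose[OF measurable_prob_algebraD[OF K] measurable_measure_subprob_algebra]) simp
  have "{x \<in> space N. quantile (K x) (f x) \<le> a} =
        {x \<in> space N. if f x \<in> {0<..<1} then f x \<le> cdf (K x) a else 0 \<le> a}"
  proof (rule Collect_cong, rule conj_cong[OF refl])
    fix x assume x: "x \<in> space N"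
    have Kx: "prob_space (K x)" "sets (K x) = sets borel"
      using measurable_space[OF K x] by (auto simp: space_prob_algebra)
    interpret cdf_distribution "K x"
      using Kx sets_eq_imp_space_eq[OF Kx(2)]
      by (simp add: cdf_distribution_def real_distribution_def real_distribution_axioms_def)
    show "(quantile (K x) (f x) \<le> a) = (if f x \<in> {0<..<1} then f x \<le> cdf (K x) a else 0 \<le> a)"
      using pseudoinverse[of "f x" a] by (auto simp: quantile_def)
  qed
  also have "\<dots> \<in> sets N" by measurable
  finally show "{x \<in> space N. quantile (K x) (f x) \<le> a} \<in> sets N" .
qed

text \<open>The uniform variable is placed on constant sequences, to be read off at coordinate 0.
  The Borel law is completed so that every universally measurable set gets a mass; the push-forward
  along the identity then cuts the completion down to \<open>Omega_M\<close>.\<close>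

definition Omega_unif :: "(nat \<Rightarrow> real) measure" where
  "Omega_unif = distr (completion (distr (restrict_space lborel {0<..<1}) Omega_B (\<lambda>u _. u))) Omega_M (\<lambda>\<omega>. \<omega>)"

lemma measurable_diagonal:
  "(\<lambda>u _. u) \<in> measurable (restrict_space lborel {0<..<1}) Omega_B"
  by (rule measurable_into_Omega_B)
     (auto simp: measurable_fun_borel space_restrict_space Omega_def intro!: measurable_restrict_space1)

lemma Omega_unif_aux:
  defines "\<mu> \<equiv> distr (restrict_space lborel {0<..<1}) Omega_B (\<lambda>u _. u)"
  shows "prob_space (completion \<mu>)" "(\<lambda>\<omega>. \<omega>) \<in> measurable (completion \<mu>) Omega_M"
proof -
  have "prob_space (restrict_space lborel {0<..<1::real})"
    by (auto simp: emeasure_restrict_space space_restrict_space intro!: prob_spaceI)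
  then have \<mu>: "prob_space \<mu>"
    unfolding \<mu>_def using measurable_diagonal by (rule prob_space.prob_space_distr)
  then show "prob_space (completion \<mu>)"
    using prob_space.emeasure_space_1[OF \<mu>] by (intro prob_spaceI) simp
  have "sets \<mu> = sets Omega_B" by (simp add: \<mu>_def)
  then show "(\<lambda>\<omega>. \<omega>) \<in> measurable (completion \<mu>) Omega_M"
    using \<mu> by (intro measurable_Omega_M_completion) auto
qed

lemma Omega_unif_in_Omega_probs: "Omega_unif \<in> Omega_probs"
  using prob_space.prob_space_distr[OF Omega_unif_aux] by (simp add: Omega_probs_def Omega_unif_def)

lemma distr_Omega_unif:
  assumes "f \<in> measurable borel N"
  shows "distr Omega_unif N (\<lambda>\<omega>. f (\<omega> 0)) = distr (restrict_space lborel {0<..<1}) N f"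
proof -
  have m: "(\<lambda>\<omega>. f (\<omega> 0)) \<in> measurable Omega_M N"
    by (rule measurable_compose[OF measurable_coord_Omega_M assms])
  have m': "(\<lambda>\<omega>. f (\<omega> 0)) \<in> measurable Omega_B N"
    by (rule measurable_compose[OF _ assms]) (intro measurable_restrict_space1 measurable_coord)
  show ?thesis
    unfolding Omega_unif_def
    by (simp add: distr_distr[OF m Omega_unif_aux(2)] comp_def m' distr_completion
        distr_distr[OF m' measurable_diagonal])
qed

text \<open>Quantiles exist only for laws on the line, hence the detour through
  \<open>real_encode\<close>. Since \<open>real_decode\<close> lands in \<open>Omega\<close> for
  every real, so does this map for every \<nu>.\<close>

definition randomize :: "(nat \<Rightarrow> real) measure \<Rightarrow> (nat \<Rightarrow> real) \<Rightarrow> nat \<Rightarrow> real" where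
  "randomize \<nu> \<omega> = real_decode (quantile (distr \<nu> borel real_encode) (\<omega> 0))"

lemma randomize_in_Omega: "randomize \<nu> \<omega> \<in> Omega"
  by (simp add: randomize_def real_decode_def omega_of_bits_in_Omega)

lemma measurable_randomize:
  assumes "K \<in> measurable N (prob_algebra borel)" "(\<lambda>x. f x 0) \<in> borel_measurable N"
  shows "(\<lambda>x. randomize (K x) (f x)) \<in> borel_measurable N"
  unfolding randomize_def
  by (intro measurable_compose[OF measurable_quantile measurable_real_decode] assms(2)
      measurable_compose[OF assms(1)] measurable_distr_prob_space measurable_real_encode)

lemma distr_randomize:
  assumes "prob_space \<nu>" "sets \<nu> = sets borel"
  shows "distr Omega_unif borel (randomize \<nu>) = distr \<nu> borel clip"
proof -
  have e: "real_encode \<in> borel_measurable \<nu>"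
    using measurable_real_encode by (simp add: assms(2) cong: measurable_cong_sets)
  define \<eta> where "\<eta> = distr \<nu> borel real_encode"
  have "prob_space \<eta>"
    unfolding \<eta>_def using assms(1) e by (rule prob_space.prob_space_distr)
  then have \<eta>: "real_distribution \<eta>"
    by (simp add: \<eta>_def real_distribution_def real_distribution_axioms_def)
  have "\<eta> \<in> space (prob_algebra borel)"
    using \<open>prob_space \<eta>\<close> by (simp add: space_prob_algebra \<eta>_def)
  then have q: "quantile \<eta> \<in> borel_measurable borel"
    using measurable_quantile[of "\<lambda>_. \<eta>" borel "\<lambda>x. x"] by simp
  have "distr Omega_unif borel (randomize \<nu>)
      = distr (restrict_space lborel {0<..<1}) borel (\<lambda>u. real_decode (quantile \<eta> u))"
    using distr_Omega_unif[OF measurable_compose[OF q measurable_real_decode]]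
    by (simp add: randomize_def[abs_def] \<eta>_def)
  also have "\<dots> = distr (distr (restrict_space lborel {0<..<1}) borel (quantile \<eta>)) borel real_decode"
    using measurable_real_decode q
    by (subst distr_distr) (auto simp: comp_def intro!: measurable_restrict_space1)
  also have "\<dots> = distr \<eta> borel real_decode"
    by (simp add: distr_quantile[OF \<eta>])
  also have "\<dots> = distr \<nu> borel clip"
    unfolding \<eta>_def using e measurable_real_decode
    by (subst distr_distr) (auto simp: comp_def real_decode_encode intro!: distr_cong)
  finally show ?thesis .
qed

section \<open>Sequences of standard spaces\<close>

lemma measurable_induced_M_I:
  assumes S: "quasi_universal_space S" and f: "f \<in> pts S \<rightarrow> space N"
    and adm: "\<And>\<alpha>. \<alpha> \<in> adm S \<Longrightarrow> (\<lambda>\<omega>. f (\<alpha> \<omega>)) \<in> measurable Omega_M N"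
  shows "f \<in> measurable (induced_M S) N"
proof (rule measurableI)
  show "f x \<in> space N" if "x \<in> space (induced_M S)" for x
    using f that by auto
  fix A assume A: "A \<in> sets N"
  have "\<alpha> -` (f -` A \<inter> pts S) \<inter> Omega \<in> sets Omega_M" if \<alpha>: "\<alpha> \<in> adm S" for \<alpha>
  proof -
    have "\<alpha> \<in> Omega \<rightarrow> pts S"
      using S \<alpha> by (auto simp: quasi_universal_space_def)
    then have "\<alpha> -` (f -` A \<inter> pts S) \<inter> Omega = (\<lambda>\<omega>. f (\<alpha> \<omega>)) -` A \<inter> space Omega_M"
      by auto
    then show ?thesis
      using measurable_sets[OF adm[OF \<alpha>] A] by simp
  qed
  then show "f -` A \<inter> space (induced_M S) \<in> sets (induced_M S)"
    by (simp add: sets_induced_M[OF S])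
qed

lemma prob_qus_ptsE:
  assumes "quasi_universal_space S" "\<mu> \<in> pts (prob_qus S)"
  obtains Y P where "Y \<in> adm S" "P \<in> Omega_probs" "prob_space P" "sets P = sets Omega_M" "space P = Omega"
    "Y \<in> measurable P (induced_M S)" "\<mu> = distr P (induced_M S) Y"
proof -
  obtain Y P where Y: "Y \<in> adm S" and P: "P \<in> Omega_probs" and \<mu>: "\<mu> = distr P (induced_M S) Y"
    using assms by (auto simp: prob_qus_def)
  have P': "prob_space P" "sets P = sets Omega_M" using P by (auto simp: Omega_probs_def)
  have "Y \<in> measurable P (induced_M S)"
    using adm_measurable[OF assms(1) Y] by (simp add: P'(2) cong: measurable_cong_sets)
  then show thesis
    using that[OF Y P P' _ _ \<mu>] sets_eq_imp_space_eq[OF P'(2)] by simp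
qed

lemma prob_qus_pts_prob_space:
  assumes "quasi_universal_space S" "\<mu> \<in> pts (prob_qus S)"
  shows "prob_space \<mu>" "sets \<mu> = sets (induced_M S)" "space \<mu> = pts S"
proof -
  obtain Y P where "Y \<in> adm S" "P \<in> Omega_probs" and Y: "prob_space P" "sets P = sets Omega_M" "space P = Omega"
    "Y \<in> measurable P (induced_M S)" "\<mu> = distr P (induced_M S) Y"
    using assms by (rule prob_qus_ptsE)
  then show "prob_space \<mu>" "sets \<mu> = sets (induced_M S)" "space \<mu> = pts S"
    by (auto intro: prob_space.prob_space_distr)
qed

text \<open>Pulling \<open>A\<close> back along the uncurried \<open>Y\<close> gives a subset
  \<open>C\<close> of \<open>Omega \<times> Omega\<close> whose \<omega>-section has
  \<open>P\<close>-mass \<open>emeasure (q \<omega>) A\<close>. Quasi-measurability of the uncurried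
  map is precisely what \<open>measurable_section_prob\<close> asks of \<open>C\<close>.\<close>

lemma adm_prob_qus_measurable:
  assumes S: "quasi_universal_space S" and q: "q \<in> adm (prob_qus S)" and A: "A \<in> sets (induced_M S)"
  shows "(\<lambda>\<omega>. emeasure (q \<omega>) A) \<in> borel_measurable Omega_M"
proof -
  obtain Y P where Y: "Y \<in> adm_adm S" and P: "P \<in> Omega_probs"
    and q_eq: "q = (\<lambda>\<omega>\<in>Omega. distr P (induced_M S) (Y \<omega>))"
    using q by (auto simp: prob_qus_def)
  have P': "sets P = sets Omega_M" using P by (auto simp: Omega_probs_def)
  have spP: "space P = Omega" using sets_eq_imp_space_eq[OF P'] by simp
  define C where "C = {(\<omega>, \<omega>'). Y \<omega> \<omega>' \<in> A}"
  have eq: "emeasure (q \<omega>) A = emeasure P {\<omega>'\<in>Omega. (\<omega>, \<omega>') \<in> C}" if \<omega>: "\<omega> \<in> Omega" for \<omega>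
  proof -
    have "Y \<omega> \<in> adm S" using Y \<omega> by (auto simp: adm_adm_def)
    then have "Y \<omega> \<in> measurable P (induced_M S)"
      using adm_measurable[OF S] by (simp add: P' cong: measurable_cong_sets)
    moreover have "Y \<omega> -` A \<inter> space P = {\<omega>'\<in>Omega. (\<omega>, \<omega>') \<in> C}"
      by (auto simp: C_def spP)
    ultimately show ?thesis
      using \<omega> A by (simp add: q_eq emeasure_distr)
  qed
  have "(\<lambda>\<omega>. emeasure P {\<omega>'\<in>Omega. (\<omega>, \<omega>') \<in> C}) \<in> borel_measurable Omega_M"
  proof (rule measurable_section_prob[OF P])
    fix \<beta> \<gamma> :: "(nat \<Rightarrow> real) \<Rightarrow> nat \<Rightarrow> real"
    assume \<beta>: "\<beta> \<in> measurable Omega_M Omega_M" and \<gamma>: "\<gamma> \<in> measurable Omega_M Omega_M"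
    have in_maps: "restrict \<phi> Omega \<in> Omega_maps" if "\<phi> \<in> measurable Omega_M Omega_M" for \<phi>
      using that measurable_cong[of Omega_M "restrict \<phi> Omega" \<phi> Omega_M] by (simp add: Omega_maps_def)
    let ?p = "\<lambda>\<omega>\<in>Omega. (restrict \<beta> Omega \<omega>, restrict \<gamma> Omega \<omega>)"
    have sp: "\<beta> \<omega> \<in> Omega" "\<gamma> \<omega> \<in> Omega" if "\<omega> \<in> Omega" for \<omega>
      using measurable_space[OF \<beta>] measurable_space[OF \<gamma>] that by auto
    have "?p \<in> adm (pair_qus Omega_qus Omega_qus)"
      using in_maps[OF \<beta>] in_maps[OF \<gamma>] unfolding pair_qus_def Omega_qus_def qus.simps by blast
    then have "compose Omega (\<lambda>(\<omega>, \<omega>')\<in>Omega \<times> Omega. Y \<omega> \<omega>') ?p \<in> adm S"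
      using Y by (simp add: adm_adm_def quasi_measurable_def)
    from measurable_sets[OF adm_measurable[OF S this] A]
    have "compose Omega (\<lambda>(\<omega>, \<omega>')\<in>Omega \<times> Omega. Y \<omega> \<omega>') ?p -` A \<inter> Omega \<in> sets Omega_M"
      by simp
    also have "compose Omega (\<lambda>(\<omega>, \<omega>')\<in>Omega \<times> Omega. Y \<omega> \<omega>') ?p -` A \<inter> Omega = {\<omega>\<in>Omega. (\<beta> \<omega>, \<gamma> \<omega>) \<in> C}"
      using sp by (auto simp: C_def compose_def)
    finally show "{\<omega>\<in>Omega. (\<beta> \<omega>, \<gamma> \<omega>) \<in> C} \<in> sets Omega_M" .
  qed
  then show ?thesis
    by (rule measurable_cong[THEN iffD2, rotated]) (simp add: eq)
qed

text \<open>The situation in which every factor is inhabited: \<open>ret k\<close> maps the nonempty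
  set \<open>Omega\<close> into \<open>pts (X k)\<close>.\<close>

locale retract_sequence =
  fixes X :: "nat \<Rightarrow> 'a qus" and emb :: "nat \<Rightarrow> 'a \<Rightarrow> nat \<Rightarrow> real" and ret :: "nat \<Rightarrow> (nat \<Rightarrow> real) \<Rightarrow> 'a"
  assumes qus: "quasi_universal_space (X k)"
    and emb: "emb k \<in> quasi_measurable (X k) Omega_qus"
    and ret: "ret k \<in> quasi_measurable Omega_qus (X k)"
    and ret_emb: "x \<in> pts (X k) \<Longrightarrow> ret k (emb k x) = x"
begin

abbreviation prd :: "nat set \<Rightarrow> (nat \<Rightarrow> 'a) qus" where
  "prd I \<equiv> prod_qus I X"

lemma qus_prd: "quasi_universal_space (prd I)"
  using qus by (rule quasi_universal_space_prod)

lemma emb_in_Omega: "x \<in> pts (X k) \<Longrightarrow> emb k x \<in> Omega"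
  using emb[of k] by (auto simp: quasi_measurable_def Omega_qus_def)

lemma measurable_emb_adm:
  assumes "\<alpha> \<in> adm (X k)"
  shows "(\<lambda>\<omega>. emb k (\<alpha> \<omega>)) \<in> measurable Omega_M Omega_M"
proof -
  have "compose Omega (emb k) \<alpha> \<in> measurable Omega_M Omega_M"
    using emb[of k] assms by (auto simp: quasi_measurable_def Omega_qus_def Omega_maps_def)
  then show ?thesis
    by (rule measurable_cong[THEN iffD1, rotated]) (simp add: compose_def)
qed

lemma ret_adm:
  assumes "F \<in> measurable Omega_M Omega_M"
  shows "(\<lambda>\<omega>\<in>Omega. ret k (F \<omega>)) \<in> adm (X k)"
proof -
  have "restrict F Omega \<in> Omega_maps"
    using assms measurable_cong[of Omega_M "restrict F Omega" F Omega_M] by (simp add: Omega_maps_def)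
  then have "compose Omega (ret k) (restrict F Omega) \<in> adm (X k)"
    using ret[of k] by (auto simp: quasi_measurable_def Omega_qus_def)
  also have "compose Omega (ret k) (restrict F Omega) = (\<lambda>\<omega>\<in>Omega. ret k (F \<omega>))"
    by (auto simp: compose_def)
  finally show ?thesis .
qed

text \<open>The coordinate \<open>m = prod_encode (k, j)\<close> of a code depends only on the factor \<open>k \<le> m\<close>; hence the
  first \<open>n\<close> coordinates of a code are determined by \<open>X\<^sub>0, \<dots>, X\<^sub>n\<close>.\<close>

definition enc :: "nat set \<Rightarrow> (nat \<Rightarrow> 'a) \<Rightarrow> nat \<Rightarrow> real" where
  "enc I x m = (if fst (prod_decode m) \<in> I
     then emb (fst (prod_decode m)) (x (fst (prod_decode m))) (snd (prod_decode m)) else 0)"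

definition dec :: "nat set \<Rightarrow> (nat \<Rightarrow> real) \<Rightarrow> nat \<Rightarrow> 'a" where
  "dec I y = (\<lambda>k\<in>I. ret k (\<lambda>j. y (prod_encode (k, j))))"

lemma ptsD: "x \<in> pts (prd I) \<Longrightarrow> k \<in> I \<Longrightarrow> x k \<in> pts (X k)"
  by (auto simp: prod_qus_def)

lemma enc_in_Omega: "x \<in> pts (prd I) \<Longrightarrow> enc I x \<in> Omega"
  using emb_in_Omega[OF ptsD[of x I]] by (auto simp: enc_def Omega_def)

lemma dec_enc:
  assumes "x \<in> pts (prd I)"
  shows "dec I (enc I x) = x"
proof
  fix k
  have "x \<in> extensional I" using assms by (simp add: prod_qus_def PiE_def)
  then show "dec I (enc I x) k = x k"
    using ret_emb[OF ptsD[OF assms]] by (auto simp: dec_def enc_def extensional_def)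
qed

lemma adm_prd_coord: "\<alpha> \<in> adm (prd I) \<Longrightarrow> k \<in> I \<Longrightarrow> (\<lambda>\<omega>\<in>Omega. \<alpha> \<omega> k) \<in> adm (X k)"
  by (auto simp: prod_qus_def)

lemma adm_prd_pts: "\<alpha> \<in> adm (prd I) \<Longrightarrow> \<omega> \<in> Omega \<Longrightarrow> \<alpha> \<omega> \<in> pts (prd I)"
  by (auto simp: prod_qus_def)

lemma measurable_enc_adm:
  assumes \<alpha>: "\<alpha> \<in> adm (prd I)"
  shows "(\<lambda>\<omega>. enc I (\<alpha> \<omega>)) \<in> measurable Omega_M Omega_M"
  unfolding measurable_Omega_M_iff measurable_fun_borel
proof (intro conjI allI funcsetI)
  show "enc I (\<alpha> \<omega>) \<in> Omega" if "\<omega> \<in> Omega" for \<omega>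
    using enc_in_Omega[OF adm_prd_pts[OF \<alpha> that]] .
  fix m
  define k j where "k = fst (prod_decode m)" and "j = snd (prod_decode m)"
  show "(\<lambda>\<omega>. enc I (\<alpha> \<omega>) m) \<in> borel_measurable Omega_M"
  proof (cases "k \<in> I")
    case True
    have "(\<lambda>\<omega>. emb k ((\<lambda>\<omega>\<in>Omega. \<alpha> \<omega> k) \<omega>) j) \<in> borel_measurable Omega_M"
      using measurable_Omega_M_borel[OF measurable_emb_adm[OF adm_prd_coord[OF \<alpha> True]]]
      by (simp only: measurable_fun_borel)
    then show ?thesis
      by (rule measurable_cong[THEN iffD1, rotated]) (use True in \<open>simp add: enc_def k_def j_def\<close>)
  qed (simp add: enc_def k_def)
qed

lemma dec_in_pts: "y \<in> Omega \<Longrightarrow> dec I y \<in> pts (prd I)"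
proof -
  assume "y \<in> Omega"
  then have "(\<lambda>j. y (prod_encode (k, j))) \<in> Omega" for k by (auto simp: Omega_def)
  then show ?thesis
    using ret by (fastforce simp: dec_def prod_qus_def quasi_measurable_def Omega_qus_def)
qed

lemma dec_adm:
  assumes F: "F \<in> measurable Omega_M Omega_M"
  shows "(\<lambda>\<omega>\<in>Omega. dec I (F \<omega>)) \<in> adm (prd I)"
proof -
  have "(\<lambda>\<omega>\<in>Omega. (\<lambda>\<omega>\<in>Omega. dec I (F \<omega>)) \<omega> k) \<in> adm (X k)" if k: "k \<in> I" for k
  proof -
    have "(\<lambda>\<omega> j. F \<omega> (prod_encode (k, j))) \<in> measurable Omega_M Omega_M"
      using F by (auto simp: measurable_Omega_M_iff measurable_fun_borel Omega_def)
    from ret_adm[OF this, of k] show ?thesis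
      using k by (simp add: dec_def cong: restrict_cong)
  qed
  moreover have "dec I (F \<omega>) \<in> pts (prd I)" if "\<omega> \<in> Omega" for \<omega>
    using measurable_space[OF F] that by (intro dec_in_pts) simp
  ultimately show ?thesis
    by (simp add: prod_qus_def)
qed

lemma measurable_enc: "enc I \<in> borel_measurable (induced_M (prd I))"
  by (intro measurable_induced_M_I[OF qus_prd] measurable_Omega_M_borel[OF measurable_enc_adm]) auto

lemma measurable_dec: "dec I \<in> measurable Omega_M (induced_M (prd I))"
proof -
  have "(\<lambda>\<omega>\<in>Omega. dec I \<omega>) \<in> measurable Omega_M (induced_M (prd I))"
    by (intro adm_measurable[OF qus_prd] dec_adm) simp
  then show ?thesis
    by (rule measurable_cong[THEN iffD1, rotated]) simp
qed

lemma restrict_adm: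
  assumes "\<alpha> \<in> adm (prd J)" "I \<subseteq> J"
  shows "(\<lambda>\<omega>\<in>Omega. restrict (\<alpha> \<omega>) I) \<in> adm (prd I)"
proof -
  have "(\<lambda>\<omega>\<in>Omega. (\<lambda>\<omega>\<in>Omega. restrict (\<alpha> \<omega>) I) \<omega> k) = (\<lambda>\<omega>\<in>Omega. \<alpha> \<omega> k)" if "k \<in> I" for k
    using that by auto
  moreover have "(\<lambda>\<omega>\<in>Omega. \<alpha> \<omega> k) \<in> adm (X k)" if "k \<in> I" for k
    using adm_prd_coord[OF assms(1)] assms(2) that by auto
  moreover have "restrict (\<alpha> \<omega>) I \<in> (\<Pi>\<^sub>E k\<in>I. pts (X k))" if "\<omega> \<in> Omega" for \<omega>
    using ptsD[OF adm_prd_pts[OF assms(1) that]] assms(2) by auto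
  ultimately show ?thesis
    by (simp add: prod_qus_def)
qed

lemma measurable_restrict_prd:
  assumes "I \<subseteq> J"
  shows "(\<lambda>x. restrict x I) \<in> measurable (induced_M (prd J)) (induced_M (prd I))"
proof (rule measurable_induced_M_I[OF qus_prd])
  show "(\<lambda>x. restrict x I) \<in> pts (prd J) \<rightarrow> space (induced_M (prd I))"
    using assms by (auto simp: prod_qus_def)
  fix \<alpha> assume "\<alpha> \<in> adm (prd J)"
  from adm_measurable[OF qus_prd restrict_adm[OF this assms]]
  show "(\<lambda>\<omega>. restrict (\<alpha> \<omega>) I) \<in> measurable Omega_M (induced_M (prd I))"
    by (rule measurable_cong[THEN iffD1, rotated]) simp
qed

text \<open>The image of \<open>enc I\<close> need not be Borel. The argument never mentions it: equality of Borel laws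
  extends to universally measurable sets and is then pushed forward along \<open>dec I\<close>.\<close>

lemma distr_dec_eqI:
  assumes \<mu>: "\<mu> \<in> pts (prob_qus (prd I))" and P: "P \<in> Omega_probs"
    and F: "F \<in> measurable Omega_M Omega_M"
    and law: "distr P borel F = distr \<mu> borel (enc I)"
  shows "distr P (induced_M (prd I)) (\<lambda>\<omega>. dec I (F \<omega>)) = \<mu>"
proof -
  obtain Y R where Y: "Y \<in> adm (prd I)" and R: "R \<in> Omega_probs" "prob_space R" "sets R = sets Omega_M" "space R = Omega"
    and Ym: "Y \<in> measurable R (induced_M (prd I))" and \<mu>_eq: "\<mu> = distr R (induced_M (prd I)) Y"
    using qus_prd \<mu> by (rule prob_qus_ptsE)
  have P': "prob_space P" "sets P = sets Omega_M" using P by (auto simp: Omega_probs_def)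
  have spP: "space P = Omega" using sets_eq_imp_space_eq[OF P'(2)] by simp
  have FP: "F \<in> measurable P Omega_M" "F \<in> borel_measurable P"
    using F measurable_Omega_M_borel[OF F] by (simp_all add: P'(2) cong: measurable_cong_sets)
  have EY: "(\<lambda>\<omega>. enc I (Y \<omega>)) \<in> measurable R Omega_M" "(\<lambda>\<omega>. enc I (Y \<omega>)) \<in> borel_measurable R"
    using measurable_enc_adm[OF Y] measurable_Omega_M_borel[OF measurable_enc_adm[OF Y]]
    by (simp_all add: R(3) cong: measurable_cong_sets)
  have law': "distr P borel F = distr R borel (\<lambda>\<omega>. enc I (Y \<omega>))"
    using Ym measurable_enc by (simp add: law \<mu>_eq distr_distr comp_def)
  have "distr P Omega_M F = distr R Omega_M (\<lambda>\<omega>. enc I (Y \<omega>))"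
  proof (rule Omega_probs_eqI)
    show "distr P Omega_M F \<in> Omega_probs" "distr R Omega_M (\<lambda>\<omega>. enc I (Y \<omega>)) \<in> Omega_probs"
      using P' R FP EY by (auto simp: Omega_probs_def intro: prob_space.prob_space_distr)
    fix A assume A: "A \<in> sets Omega_B"
    then obtain B where B: "B \<in> sets borel" "A = Omega \<inter> B"
      by (auto simp: sets_restrict_space)
    have "F -` A \<inter> space P = F -` B \<inter> space P"
      "(\<lambda>\<omega>. enc I (Y \<omega>)) -` A \<inter> space R = (\<lambda>\<omega>. enc I (Y \<omega>)) -` B \<inter> space R"
      using measurable_space[OF FP(1)] measurable_space[OF EY(1)] by (auto simp: B(2))
    then show "emeasure (distr P Omega_M F) A = emeasure (distr R Omega_M (\<lambda>\<omega>. enc I (Y \<omega>))) A"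
      using FP EY subsetD[OF sets_Omega_B_subset A] B(1) arg_cong[OF law', of "\<lambda>M. emeasure M B"]
      by (simp add: emeasure_distr)
  qed
  then have "distr (distr P Omega_M F) (induced_M (prd I)) (dec I)
      = distr (distr R Omega_M (\<lambda>\<omega>. enc I (Y \<omega>))) (induced_M (prd I)) (dec I)"
    by simp
  then have "distr P (induced_M (prd I)) (\<lambda>\<omega>. dec I (F \<omega>))
      = distr R (induced_M (prd I)) (\<lambda>\<omega>. dec I (enc I (Y \<omega>)))"
    using FP EY measurable_dec by (simp add: distr_distr comp_def)
  also have "\<dots> = \<mu>"
    unfolding \<mu>_eq using adm_prd_pts[OF Y] by (intro distr_cong) (auto simp: R dec_enc)
  finally show ?thesis .
qed

text \<open>Write \<mu> as the law of some \<open>Y\<close> under \<open>P\<close>. The code of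
  \<open>Y\<close> has the Borel law belonging to \<mu>', so decoding it produces \<mu>'; but
  decoding a code returns \<open>Y\<close> itself, whose law is \<mu>.\<close>

lemma prob_qus_eqI:
  assumes \<mu>: "\<mu> \<in> pts (prob_qus (prd I))" and \<mu>': "\<mu>' \<in> pts (prob_qus (prd I))"
    and law: "distr \<mu> borel (enc I) = distr \<mu>' borel (enc I)"
  shows "\<mu> = \<mu>'"
proof -
  obtain Y P where Y: "Y \<in> adm (prd I)" and P: "P \<in> Omega_probs" "space P = Omega"
    and Ym: "Y \<in> measurable P (induced_M (prd I))" and \<mu>_eq: "\<mu> = distr P (induced_M (prd I)) Y"
    using qus_prd \<mu> by (rule prob_qus_ptsE)
  have "distr P (induced_M (prd I)) (\<lambda>\<omega>. dec I (enc I (Y \<omega>))) = \<mu>'"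
    using Ym measurable_enc
    by (intro distr_dec_eqI \<mu>' P measurable_enc_adm Y)
       (simp add: law[symmetric], simp add: \<mu>_eq distr_distr comp_def)
  moreover have "distr P (induced_M (prd I)) (\<lambda>\<omega>. dec I (enc I (Y \<omega>))) = \<mu>"
    unfolding \<mu>_eq using adm_prd_pts[OF Y] by (intro distr_cong) (auto simp: P dec_enc)
  ultimately show ?thesis by simp
qed


subsection \<open>Borel laws of consistent families\<close>

lemma enc_restrict: "fst (prod_decode m) \<in> I \<Longrightarrow> enc I (restrict x I) m = enc J x m"
  if "I \<subseteq> J"
  using that by (auto simp: enc_def)

lemma fst_prod_decode_le: "fst (prod_decode m) \<le> m"
  using le_prod_encode_1[of "fst (prod_decode m)" "snd (prod_decode m)"] by simp

lemma enc_restrict_atMost: "i \<le> m \<Longrightarrow> m \<le> n \<Longrightarrow> enc {0..m} (restrict x {0..m}) i = enc {0..n} x i"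
  using fst_prod_decode_le[of i] by (intro enc_restrict) auto

lemma measurable_restrict_enc:
  "(\<lambda>x. restrict (enc I x) J) \<in> measurable (induced_M (prd I)) (PiM J (\<lambda>_. borel))"
  using measurable_enc[of I]
  by (intro measurable_restrict) (simp add: measurable_fun_borel)

definition consistent :: "(nat \<Rightarrow> (nat \<Rightarrow> 'a) measure) \<Rightarrow> bool" where
  "consistent q \<longleftrightarrow> (\<forall>n. q n \<in> pts (prob_qus (prd {0..n})) \<and>
     distr (q (Suc n)) (induced_M (prd {0..n})) (\<lambda>x. restrict x {0..n}) = q n)"

lemma consistent_le:
  assumes "consistent q" "m \<le> n"
  shows "distr (q n) (induced_M (prd {0..m})) (\<lambda>x. restrict x {0..m}) = q m"
  using assms(2)
proof (induction n rule: dec_induct)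
  case base
  have q: "sets (q m) = sets (induced_M (prd {0..m}))" "space (q m) = pts (prd {0..m})"
    using assms(1) prob_qus_pts_prob_space[OF qus_prd] by (auto simp: consistent_def)
  have "distr (q m) (induced_M (prd {0..m})) (\<lambda>x. restrict x {0..m}) = distr (q m) (q m) (\<lambda>x. x)"
    using q by (intro distr_cong) (auto simp: prod_qus_def)
  then show ?case by (simp only: distr_id)
next
  case (step n)
  have s: "sets (q (Suc n)) = sets (induced_M (prd {0..Suc n}))"
    using assms(1) prob_qus_pts_prob_space[OF qus_prd] by (auto simp: consistent_def)
  have m: "(\<lambda>x. restrict x {0..n}) \<in> measurable (q (Suc n)) (induced_M (prd {0..n}))"
    using measurable_restrict_prd[of "{0..n}" "{0..Suc n}"] by (simp add: s cong: measurable_cong_sets)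
  have "q m = distr (distr (q (Suc n)) (induced_M (prd {0..n})) (\<lambda>x. restrict x {0..n}))
      (induced_M (prd {0..m})) (\<lambda>x. restrict x {0..m})"
    using step.IH assms(1) unfolding consistent_def by metis
  also have "\<dots> = distr (q (Suc n)) (induced_M (prd {0..m})) (\<lambda>x. restrict (restrict x {0..n}) {0..m})"
    using step.hyps by (subst distr_distr[OF measurable_restrict_prd m]) (auto simp: comp_def)
  also have "\<dots> = distr (q (Suc n)) (induced_M (prd {0..m})) (\<lambda>x. restrict x {0..m})"
    using step.hyps by (intro distr_cong) (auto simp: Int_absorb1)
  finally show ?case by (rule sym)
qed

text \<open>\<nu> plays the role of the law of the code of the whole sequence. The condition ranges
  over all \<open>n\<close> bounding \<open>J\<close>, so that later arguments may read a cylinder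
  off any sufficiently late \<open>q n\<close>.\<close>

definition is_limit :: "(nat \<Rightarrow> (nat \<Rightarrow> 'a) measure) \<Rightarrow> (nat \<Rightarrow> real) measure \<Rightarrow> bool" where
  "is_limit q \<nu> \<longleftrightarrow> prob_space \<nu> \<and> sets \<nu> = sets borel \<and>
     (\<forall>n J A. J \<subseteq> {0..n} \<longrightarrow> A \<in> sets (PiM J (\<lambda>_. borel)) \<longrightarrow>
        emeasure \<nu> (prod_emb UNIV (\<lambda>_. borel) J A) =
        emeasure (q n) ((\<lambda>x. restrict (enc {0..n} x) J) -` A \<inter> pts (prd {0..n})))"

lemma ex_is_limit:
  assumes q: "consistent q"
  shows "\<exists>\<nu>. is_limit q \<nu>"
proof -
  have q': "prob_space (q n)" "sets (q n) = sets (induced_M (prd {0..n}))" "space (q n) = pts (prd {0..n})" for n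
    using q prob_qus_pts_prob_space[OF qus_prd] by (auto simp: consistent_def)
  define L where "L n J = distr (q n) (PiM J (\<lambda>_. borel)) (\<lambda>x. restrict (enc {0..n} x) J)" for n and J :: "nat set"
  have m: "(\<lambda>x. restrict (enc {0..n} x) J) \<in> measurable (q n) (PiM J (\<lambda>_. borel))" for n J
    using measurable_restrict_enc[of "{0..n}"] by (simp add: q' cong: measurable_cong_sets)
  \<comment> \<open>Code coordinates up to \<open>m\<close> involve only factors up to
    \<open>m\<close>, so by consistency a later \<open>q n\<close> induces the same law on them.
    This makes \<open>P\<close> below independent of the stage at which it is read.\<close>
  have L_mono: "L m J = L n J" if "m \<le> n" "J \<subseteq> {0..m}" for m n J
  proof -
    have r: "(\<lambda>x. restrict x {0..m}) \<in> measurable (q n) (induced_M (prd {0..m}))"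
      using measurable_restrict_prd[of "{0..m}" "{0..n}"] that by (simp add: q' cong: measurable_cong_sets)
    have "L m J = distr (distr (q n) (induced_M (prd {0..m})) (\<lambda>x. restrict x {0..m}))
        (PiM J (\<lambda>_. borel)) (\<lambda>x. restrict (enc {0..m} x) J)"
      by (simp add: L_def consistent_le[OF q that(1)])
    also have "\<dots> = distr (q n) (PiM J (\<lambda>_. borel)) (\<lambda>x. restrict (enc {0..m} (restrict x {0..m})) J)"
      by (subst distr_distr[OF measurable_restrict_enc r]) (simp add: comp_def)
    also have "\<dots> = L n J"
      unfolding L_def using that enc_restrict_atMost
      by (intro distr_cong) (auto intro!: restrict_ext)
    finally show ?thesis .
  qed
  \<comment> \<open>Inserting 0 gives the maximum a meaning for empty \<open>J\<close>.\<close>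
  define b where "b J = Max (insert 0 J)" for J :: "nat set"
  have b: "J \<subseteq> {0..b J}" if "finite J" for J
    using that by (auto simp: b_def)
  define P where "P J = L (b J) J" for J
  have P_eq: "P J = L n J" if "J \<subseteq> {0..n}" for n J
  proof -
    have "finite J" using that finite_subset by blast
    then have "b J \<le> n" using that by (auto simp: b_def)
    then show ?thesis
      unfolding P_def using b[OF \<open>finite J\<close>] by (intro L_mono)
  qed
  interpret polish_projective UNIV P
    unfolding polish_projective_def
  proof (rule projective_family.intro)
    fix J H :: "nat set" assume "J \<subseteq> H" "finite H"
    then have "J \<subseteq> {0..b H}" using b by blast
    then have "P J = L (b H) J" by (rule P_eq)
    also have "\<dots> = distr (q (b H)) (PiM J (\<lambda>_. borel)) (\<lambda>x. restrict (restrict (enc {0..b H} x) H) J)"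
      unfolding L_def using \<open>J \<subseteq> H\<close> by (intro distr_cong) (auto simp: Int_absorb1)
    also have "\<dots> = distr (P H) (PiM J (\<lambda>_. borel)) (\<lambda>f. restrict f J)"
      unfolding P_def L_def using measurable_restrict_subset[OF \<open>J \<subseteq> H\<close>]
      by (subst distr_distr[OF _ m]) (auto simp: comp_def)
    finally show "P J = distr (P H) (PiM J (\<lambda>_. borel)) (\<lambda>f. restrict f J)" .
  next
    show "prob_space (P J)" for J
      unfolding P_def L_def using q' m by (intro prob_space.prob_space_distr)
  qed
  have "is_limit q lim"
    unfolding is_limit_def
  proof (intro conjI allI impI)
    show "prob_space lim" by (rule P.prob_space_axioms)
    show "sets lim = sets borel" using sets_PiM_equal_borel by simp
    fix n J and A :: "(nat \<Rightarrow> real) set"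
    assume J: "J \<subseteq> {0..n}" and A: "A \<in> sets (PiM J (\<lambda>_. borel))"
    have "finite J" using J finite_subset by blast
    then have "emeasure lim (prod_emb UNIV (\<lambda>_. borel) J A) = emeasure (P J) A"
      using A by (intro emeasure_lim_emb) auto
    also have "\<dots> = emeasure (q n) ((\<lambda>x. restrict (enc {0..n} x) J) -` A \<inter> pts (prd {0..n}))"
      using A m by (simp add: P_eq[OF J] L_def emeasure_distr q')
    finally show "emeasure lim (prod_emb UNIV (\<lambda>_. borel) J A) =
        emeasure (q n) ((\<lambda>x. restrict (enc {0..n} x) J) -` A \<inter> pts (prd {0..n}))" .
  qed
  then show ?thesis ..
qed

text \<open>The limit is only known on finitely many coordinates at a time and is not yet known to be carried
  by \<open>[0,1]\<close>-valued sequences, whence the \<open>clip\<close> below.\<close>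

definition truncate :: "nat \<Rightarrow> (nat \<Rightarrow> real) \<Rightarrow> nat \<Rightarrow> real" where
  "truncate n y m = (if fst (prod_decode m) \<le> n then y m else 0)"

lemma measurable_truncate: "truncate n \<in> borel_measurable borel"
  unfolding measurable_fun_borel
proof
  show "(\<lambda>y. truncate n y m) \<in> borel_measurable borel" for m
    by (cases "fst (prod_decode m) \<le> n") (simp_all add: truncate_def measurable_coord)
qed

lemma dec_truncate: "dec {0..n} (truncate n y) = restrict (dec UNIV y) {0..n}"
  by (auto simp: dec_def truncate_def)

text \<open>The coordinates belonging to the factors up to \<open>n\<close> have unbounded indices,
  so \<open>q n\<close> is too early a stage for a cylinder over arbitrary \<open>J\<close>. The
  cylinder is evaluated at a stage \<open>N\<close> beyond both \<open>n\<close> and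
  \<open>J\<close>, and consistency brings the result back to \<open>q n\<close>.\<close>

lemma distr_truncate:
  assumes q: "consistent q" and \<nu>: "is_limit q \<nu>"
  shows "distr \<nu> borel (\<lambda>y. truncate n (clip y)) = distr (q n) borel (enc {0..n})"
proof (rule measure_eqI_PiM_infinite)
  have q': "prob_space (q n)" "sets (q n) = sets (induced_M (prd {0..n}))" "space (q n) = pts (prd {0..n})" for n
    using q prob_qus_pts_prob_space[OF qus_prd] by (auto simp: consistent_def)
  have \<nu>': "prob_space \<nu>" "sets \<nu> = sets borel"
    using \<nu> by (auto simp: is_limit_def)
  have sp\<nu>: "space \<nu> = UNIV" using sets_eq_imp_space_eq[OF \<nu>'(2)] by simp
  have tm: "(\<lambda>y. truncate n (clip y)) \<in> borel_measurable \<nu>"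
    using measurable_compose[OF measurable_clip measurable_truncate]
    by (simp add: \<nu>'(2) cong: measurable_cong_sets)
  have em: "enc {0..n} \<in> borel_measurable (q n)" for n
    using measurable_enc by (simp add: q' cong: measurable_cong_sets)
  show "sets (distr \<nu> borel (\<lambda>y. truncate n (clip y))) = sets (PiM UNIV (\<lambda>_. borel))"
    "sets (distr (q n) borel (enc {0..n})) = sets (PiM UNIV (\<lambda>_. borel))"
    by (simp_all add: sets_PiM_equal_borel)
  show "finite_measure (distr \<nu> borel (\<lambda>y. truncate n (clip y)))"
    using prob_space.finite_measure[OF prob_space.prob_space_distr[OF \<nu>'(1) tm]] .
  fix A :: "nat \<Rightarrow> real set" and J :: "nat set"
  assume J: "finite J" and A: "\<And>i. i \<in> J \<Longrightarrow> A i \<in> sets borel"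
  define N where "N = Max (insert n J)"
  have N: "J \<subseteq> {0..N}" "n \<le> N" using J by (auto simp: N_def)
  \<comment> \<open>Truncation and clipping act on each coordinate separately, so the preimage of a
    box is again a box, with these sides.\<close>
  define A' where "A' i = {t::real. (if fst (prod_decode i) \<le> n then min 1 (max 0 t) else 0) \<in> A i}" for i
  have A': "A' i \<in> sets borel" if "i \<in> J" for i
    using measurable_sets[of "\<lambda>t::real. if fst (prod_decode i) \<le> n then min 1 (max 0 t) else 0" borel borel "A i"] A[OF that]
    by (simp add: A'_def vimage_def)
  let ?E = "prod_emb UNIV (\<lambda>_. borel) J (Pi\<^sub>E J A) :: (nat \<Rightarrow> real) set"
  have E: "?E \<in> sets borel"
    using sets_PiM_I[of J UNIV A "\<lambda>_. borel"] J A by (simp add: sets_PiM_equal_borel)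
  have E_iff: "y \<in> ?E \<longleftrightarrow> (\<forall>i\<in>J. y i \<in> A i)" for y
    by (auto simp: prod_emb_def PiE_iff)
  have r: "(\<lambda>x. restrict x {0..n}) \<in> measurable (q N) (induced_M (prd {0..n}))"
    using measurable_restrict_prd[of "{0..n}" "{0..N}"] N by (simp add: q' cong: measurable_cong_sets)
  have "emeasure (distr \<nu> borel (\<lambda>y. truncate n (clip y))) ?E
      = emeasure \<nu> ((\<lambda>y. truncate n (clip y)) -` ?E \<inter> space \<nu>)"
    using tm E by (rule emeasure_distr)
  also have "(\<lambda>y. truncate n (clip y)) -` ?E \<inter> space \<nu> = prod_emb UNIV (\<lambda>_. borel) J (Pi\<^sub>E J A')"
    by (auto simp: sp\<nu> E_iff prod_emb_def PiE_iff A'_def truncate_def clip_def split: if_splits)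
  also have "emeasure \<nu> \<dots> = emeasure (q N) ((\<lambda>x. restrict (enc {0..N} x) J) -` (Pi\<^sub>E J A') \<inter> pts (prd {0..N}))"
    using \<nu> N(1) A' J unfolding is_limit_def by (blast intro: sets_PiM_I_finite)
  also have "(\<lambda>x. restrict (enc {0..N} x) J) -` (Pi\<^sub>E J A') \<inter> pts (prd {0..N})
      = (\<lambda>x. restrict x {0..n}) -` (enc {0..n} -` ?E \<inter> pts (prd {0..n})) \<inter> pts (prd {0..N})"
  proof (intro set_eqI, goal_cases)
    case (1 x)
    show ?case
    proof (cases "x \<in> pts (prd {0..N})")
      case True
      have "restrict x {0..n} \<in> pts (prd {0..n})"
        using True N(2) by (auto simp: prod_qus_def)
      \<comment> \<open>Codes already lie in \<open>[0,1]\<close>, so clipping leaves them fixed.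
        For coordinates of factors beyond \<open>n\<close> both sides ask whether
        \<open>0 \<in> A i\<close>, because \<open>enc\<close> and \<open>truncate\<close> share the
        default 0.\<close>
      moreover have "enc {0..N} x i \<in> A' i \<longleftrightarrow> enc {0..n} (restrict x {0..n}) i \<in> A i" for i
      proof (cases "fst (prod_decode i) \<le> n")
        case le: True
        have "enc {0..n} (restrict x {0..n}) i = enc {0..N} x i"
          using le N(2) by (intro enc_restrict) auto
        moreover have "min 1 (max 0 (enc {0..N} x i)) = enc {0..N} x i"
          using enc_in_Omega[OF True] clip_id[of "enc {0..N} x"] by (simp add: clip_def fun_eq_iff)
        ultimately show ?thesis
          using le by (simp add: A'_def)
      qed (simp add: A'_def enc_def)
      ultimately show ?thesis
        using True by (auto simp: E_iff PiE_iff)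
    qed auto
  qed
  also have "emeasure (q N) \<dots> = emeasure (distr (q N) (induced_M (prd {0..n})) (\<lambda>x. restrict x {0..n}))
      (enc {0..n} -` ?E \<inter> pts (prd {0..n}))"
    using measurable_sets[OF em E, of n] q' by (subst emeasure_distr[OF r]) auto
  also have "\<dots> = emeasure (q n) (enc {0..n} -` ?E \<inter> space (q n))"
    by (simp add: consistent_le[OF q N(2)] q')
  also have "\<dots> = emeasure (distr (q n) borel (enc {0..n})) ?E"
    using em E by (rule emeasure_distr[symmetric])
  finally show "emeasure (distr \<nu> borel (\<lambda>y. truncate n (clip y))) ?E = emeasure (distr (q n) borel (enc {0..n})) ?E" .
qed

text \<open>The limits may be picked separately for each \<omega>: \<open>is_limit\<close> forces
  the mass of a cylinder to be \<open>emeasure (q n \<omega>) B\<close> with \<open>n\<close> and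
  \<open>B\<close> independent of \<omega>, and cylinders generate the Borel sets.\<close>

lemma measurable_limit:
  assumes q: "\<And>\<omega>. \<omega> \<in> Omega \<Longrightarrow> is_limit (\<lambda>n. q n \<omega>) (\<nu> \<omega>)"
    and adm: "\<And>n. q n \<in> adm (prob_qus (prd {0..n}))"
  shows "\<nu> \<in> measurable Omega_M (prob_algebra borel)"
proof (rule measurable_prob_algebra_generated)
  show "sets borel = sigma_sets (\<Pi>\<^sub>E i\<in>UNIV. space borel) (prod_algebra UNIV (\<lambda>_::nat. borel :: real measure))"
    using sets_PiM[of UNIV "\<lambda>_::nat. borel :: real measure"] by (simp add: sets_PiM_equal_borel)
  show "Int_stable (prod_algebra UNIV (\<lambda>_::nat. borel :: real measure))"
    by (rule Int_stable_prod_algebra)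
  show "prod_algebra UNIV (\<lambda>_::nat. borel :: real measure) \<subseteq> Pow (\<Pi>\<^sub>E i\<in>UNIV. space borel)"
    by (rule prod_algebra_sets_into_space)
  show "prob_space (\<nu> \<omega>)" "sets (\<nu> \<omega>) = sets borel" if "\<omega> \<in> space Omega_M" for \<omega>
    using q[of \<omega>] that by (auto simp: is_limit_def)
  fix E assume "E \<in> prod_algebra UNIV (\<lambda>_::nat. borel :: real measure)"
  then obtain J A where E: "E = prod_emb UNIV (\<lambda>_. borel) J (Pi\<^sub>E J A)" and J: "finite J"
    and A: "\<And>i. i \<in> J \<Longrightarrow> A i \<in> sets borel"
    by (rule prod_algebraE) (rule that, assumption, assumption, simp)
  define n where "n = Max (insert 0 J)"
  have n: "J \<subseteq> {0..n}" using J by (auto simp: n_def)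
  have PA: "Pi\<^sub>E J A \<in> sets (PiM J (\<lambda>_. borel))"
    using J A by (intro sets_PiM_I_finite)
  let ?B = "(\<lambda>x. restrict (enc {0..n} x) J) -` (Pi\<^sub>E J A) \<inter> pts (prd {0..n})"
  have "?B \<in> sets (induced_M (prd {0..n}))"
    using measurable_sets[OF measurable_restrict_enc PA, of "{0..n}"] by simp
  then have "(\<lambda>\<omega>. emeasure (q n \<omega>) ?B) \<in> borel_measurable Omega_M"
    by (rule adm_prob_qus_measurable[OF qus_prd adm])
  then show "(\<lambda>\<omega>. emeasure (\<nu> \<omega>) E) \<in> borel_measurable Omega_M"
    by (rule measurable_cong[THEN iffD1, rotated])
       (use q n PA in \<open>auto simp: is_limit_def E\<close>)
qed

text \<open>Borel laws of codes are determined by cylinders. A cylinder over \<open>J\<close>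
  concerns finitely many code coordinates, which depend on \<open>restrict x {0..n}\<close> once
  \<open>n\<close> bounds \<open>J\<close>.\<close>

lemma marginals_unique:
  assumes \<mu>: "\<mu> \<in> pts (prob_qus (prd UNIV))" and \<mu>': "\<mu>' \<in> pts (prob_qus (prd UNIV))"
    and eq: "\<And>n. distr \<mu> (induced_M (prd {0..n})) (\<lambda>x. restrict x {0..n})
             = distr \<mu>' (induced_M (prd {0..n})) (\<lambda>x. restrict x {0..n})"
  shows "\<mu> = \<mu>'"
proof (rule prob_qus_eqI[OF \<mu> \<mu>'], rule measure_eqI_PiM_infinite)
  note M = prob_qus_pts_prob_space[OF qus_prd \<mu>] and M' = prob_qus_pts_prob_space[OF qus_prd \<mu>']
  show "sets (distr \<mu> borel (enc UNIV)) = sets (PiM UNIV (\<lambda>_. borel))"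
    "sets (distr \<mu>' borel (enc UNIV)) = sets (PiM UNIV (\<lambda>_. borel))"
    by (simp_all add: sets_PiM_equal_borel)
  have em: "enc UNIV \<in> borel_measurable \<mu>"
    using measurable_enc by (simp add: M cong: measurable_cong_sets)
  show "finite_measure (distr \<mu> borel (enc UNIV))"
    using prob_space.finite_measure[OF prob_space.prob_space_distr[OF M(1) em]] .
  fix A :: "nat \<Rightarrow> real set" and J :: "nat set"
  assume J: "finite J" and A: "\<And>i. i \<in> J \<Longrightarrow> A i \<in> sets borel"
  define n where "n = Max (insert 0 J)"
  have n: "J \<subseteq> {0..n}" using J by (auto simp: n_def)
  let ?E = "prod_emb UNIV (\<lambda>_. borel) J (Pi\<^sub>E J A) :: (nat \<Rightarrow> real) set"
  have E: "?E \<in> sets borel"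
    using sets_PiM_I[of J UNIV A "\<lambda>_. borel"] J A by (simp add: sets_PiM_equal_borel)
  have E_iff: "y \<in> ?E \<longleftrightarrow> (\<forall>i\<in>J. y i \<in> A i)" for y
    by (auto simp: prod_emb_def PiE_iff)
  have "emeasure (distr \<kappa> borel (enc UNIV)) ?E
      = emeasure (distr \<kappa> (induced_M (prd {0..n})) (\<lambda>x. restrict x {0..n})) (enc {0..n} -` ?E \<inter> pts (prd {0..n}))"
    if \<kappa>: "sets \<kappa> = sets (induced_M (prd UNIV))" "space \<kappa> = pts (prd UNIV)" for \<kappa>
  proof -
    have em: "enc UNIV \<in> borel_measurable \<kappa>"
      using measurable_enc by (simp add: \<kappa> cong: measurable_cong_sets)
    have r: "(\<lambda>x. restrict x {0..n}) \<in> measurable \<kappa> (induced_M (prd {0..n}))"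
      using measurable_restrict_prd[of "{0..n}" UNIV] by (simp add: \<kappa> cong: measurable_cong_sets)
    have "enc UNIV -` ?E \<inter> space \<kappa>
        = (\<lambda>x. restrict x {0..n}) -` (enc {0..n} -` ?E \<inter> pts (prd {0..n})) \<inter> space \<kappa>"
    proof (intro set_eqI, goal_cases)
      case (1 x)
      have "enc {0..n} (restrict x {0..n}) i = enc UNIV x i" if "i \<in> J" for i
        using that n fst_prod_decode_le[of i] by (intro enc_restrict) auto
      moreover have "restrict x {0..n} \<in> pts (prd {0..n})" if "x \<in> space \<kappa>"
        using that by (auto simp: \<kappa> prod_qus_def)
      ultimately show ?case by (auto simp: E_iff)
    qed
    moreover have "enc {0..n} -` ?E \<inter> pts (prd {0..n}) \<in> sets (induced_M (prd {0..n}))"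
      using measurable_sets[OF measurable_enc E, of "{0..n}"] by simp
    ultimately show ?thesis
      using em r E by (simp add: emeasure_distr)
  qed
  from this[OF M(2,3)] this[OF M'(2,3)]
  show "emeasure (distr \<mu> borel (enc UNIV)) ?E = emeasure (distr \<mu>' borel (enc UNIV)) ?E"
    by (simp add: eq)
qed


section \<open>Existence and uniqueness of the limit kernel for inhabited factors\<close>

theorem ex1_projective_limit:
  assumes Z: "quasi_universal_space Z"
    and Q: "\<And>n. Q n \<in> quasi_measurable Z (prob_qus (prd {0..n}))"
    and cons: "\<And>n z. z \<in> pts Z \<Longrightarrow>
      distr (Q (Suc n) z) (induced_M (prd {0..n})) (\<lambda>x. restrict x {0..n}) = Q n z"
  shows "\<exists>!QN. QN \<in> quasi_measurable Z (prob_qus (prd UNIV)) \<and>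
           (\<forall>n. \<forall>z\<in>pts Z.
              distr (QN z) (induced_M (prd {0..n})) (\<lambda>x. restrict x {0..n}) = Q n z)"
proof (rule ex_ex1I)
  define \<nu> where "\<nu> z = (SOME \<nu>. is_limit (\<lambda>n. Q n z) \<nu>)" for z
  have Q_pts: "Q n z \<in> pts (prob_qus (prd {0..n}))" if "z \<in> pts Z" for n z
    using Q[of n] that by (auto simp: quasi_measurable_def)
  have consistent: "consistent (\<lambda>n. Q n z)" if "z \<in> pts Z" for z
    unfolding consistent_def using Q_pts[OF that] cons[OF that] by blast
  have \<nu>: "is_limit (\<lambda>n. Q n z) (\<nu> z)" if "z \<in> pts Z" for z
    unfolding \<nu>_def using ex_is_limit[OF consistent[OF that]] by (rule someI_ex)
  have Z_adm: "\<alpha> \<omega> \<in> pts Z" if "\<alpha> \<in> adm Z" "\<omega> \<in> Omega" for \<alpha> \<omega>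
    using Z that by (auto simp: quasi_universal_space_def)
  \<comment> \<open>All dependence on \<open>z\<close> sits in the random variable, while the law
    \<open>Omega_unif\<close> stays fixed, as the admissible random variables of
    \<open>prob_qus\<close> demand.\<close>
  define G where "G z = (\<lambda>\<omega>\<in>Omega. dec UNIV (randomize (\<nu> z) \<omega>))" for z
  define QN where "QN = (\<lambda>z\<in>pts Z. distr Omega_unif (induced_M (prd UNIV)) (G z))"
  have kernel: "(\<lambda>\<omega>. \<nu> (\<alpha> \<omega>)) \<in> measurable Omega_M (prob_algebra borel)" if \<alpha>: "\<alpha> \<in> adm Z" for \<alpha>
  proof (rule measurable_limit)
    show "is_limit (\<lambda>n. compose Omega (Q n) \<alpha> \<omega>) (\<nu> (\<alpha> \<omega>))" if "\<omega> \<in> Omega" for \<omega>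
      using \<nu>[OF Z_adm[OF \<alpha> that]] that by (simp add: compose_def)
    show "compose Omega (Q n) \<alpha> \<in> adm (prob_qus (prd {0..n}))" for n
      using Q[of n] \<alpha> by (auto simp: quasi_measurable_def)
  qed
  \<comment> \<open>Stated along arbitrary \<beta> and \<gamma>, since this is how
    quasi-measurability on \<open>Omega \<times> Omega\<close> is tested.\<close>
  have joint: "(\<lambda>\<omega>. randomize (\<nu> (\<alpha> (\<beta> \<omega>))) (\<gamma> \<omega>)) \<in> measurable Omega_M Omega_M"
    if \<alpha>: "\<alpha> \<in> adm Z" and \<beta>: "\<beta> \<in> measurable Omega_M Omega_M" and \<gamma>: "\<gamma> \<in> measurable Omega_M Omega_M" for \<alpha> \<beta> \<gamma>
    unfolding measurable_Omega_M_iff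
  proof
    show "(\<lambda>\<omega>. randomize (\<nu> (\<alpha> (\<beta> \<omega>))) (\<gamma> \<omega>)) \<in> borel_measurable Omega_M"
      using measurable_compose[OF \<beta> kernel[OF \<alpha>]] measurable_compose[OF \<gamma> measurable_coord_Omega_M]
      by (rule measurable_randomize)
  qed (simp add: randomize_in_Omega)
  have randomize_meas: "randomize (\<nu> z) \<in> measurable Omega_M Omega_M" if z: "z \<in> pts Z" for z
  proof -
    \<comment> \<open>The constant random variable at \<open>z\<close> reduces the case of a fixed
      point to \<open>joint\<close>.\<close>
    have "(\<lambda>\<omega>\<in>Omega. z) \<in> adm Z"
      using Z z by (auto simp: quasi_universal_space_def)
    from joint[OF this measurable_ident_sets[OF refl] measurable_ident_sets[OF refl]] show ?thesis
      by (rule measurable_cong[THEN iffD1, rotated]) simp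
  qed
  have G_adm: "G z \<in> adm (prd UNIV)" if "z \<in> pts Z" for z
    unfolding G_def using randomize_meas[OF that] by (rule dec_adm)
  have QN_pts: "QN z \<in> pts (prob_qus (prd UNIV))" if "z \<in> pts Z" for z
    using that G_adm[OF that] Omega_unif_in_Omega_probs by (auto simp: QN_def prob_qus_def)
  have unif: "sets Omega_unif = sets Omega_M" "space Omega_unif = Omega"
    using Omega_unif_in_Omega_probs sets_eq_imp_space_eq[of Omega_unif Omega_M]
    by (auto simp: Omega_probs_def)
  have marginal: "distr (QN z) (induced_M (prd {0..n})) (\<lambda>x. restrict x {0..n}) = Q n z"
    if z: "z \<in> pts Z" for n z
  proof -
    have \<nu>z: "prob_space (\<nu> z)" "sets (\<nu> z) = sets borel"
      using \<nu>[OF z] by (auto simp: is_limit_def)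
    have rm: "randomize (\<nu> z) \<in> borel_measurable Omega_unif"
      using measurable_Omega_M_borel[OF randomize_meas[OF z]] by (simp add: unif cong: measurable_cong_sets)
    \<comment> \<open>Restricting a decoded sequence to \<open>{0..n}\<close> amounts to decoding
      its truncated code. The marginal can therefore be identified through the Borel law of
      \<open>?F\<close>.\<close>
    let ?F = "\<lambda>\<omega>. truncate n (randomize (\<nu> z) \<omega>)"
    have F: "?F \<in> measurable Omega_M Omega_M"
      unfolding measurable_Omega_M_iff
      using measurable_compose[OF measurable_Omega_M_borel[OF randomize_meas[OF z]] measurable_truncate]
        randomize_in_Omega[of "\<nu> z"] by (auto simp: Omega_def truncate_def)
    have clip: "clip \<in> borel_measurable (\<nu> z)"
      using measurable_clip by (simp add: \<nu>z(2) cong: measurable_cong_sets)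
    have "distr Omega_unif borel ?F = distr (distr Omega_unif borel (randomize (\<nu> z))) borel (truncate n)"
      using rm measurable_truncate by (simp add: distr_distr comp_def)
    also have "\<dots> = distr (\<nu> z) borel (\<lambda>y. truncate n (clip y))"
      using clip measurable_truncate by (simp add: distr_randomize[OF \<nu>z] distr_distr comp_def)
    also have "\<dots> = distr (Q n z) borel (enc {0..n})"
      by (rule distr_truncate[OF consistent[OF z] \<nu>[OF z]])
    finally have "distr Omega_unif (induced_M (prd {0..n})) (\<lambda>\<omega>. dec {0..n} (?F \<omega>)) = Q n z"
      by (intro distr_dec_eqI Q_pts z Omega_unif_in_Omega_probs F)
    moreover have "distr (QN z) (induced_M (prd {0..n})) (\<lambda>x. restrict x {0..n})
        = distr Omega_unif (induced_M (prd {0..n})) (\<lambda>\<omega>. restrict (G z \<omega>) {0..n})"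
    proof -
      have "G z \<in> measurable Omega_unif (induced_M (prd UNIV))"
        using adm_measurable[OF qus_prd G_adm[OF z]] by (simp add: unif cong: measurable_cong_sets)
      then show ?thesis
        using z by (simp add: QN_def distr_distr[OF measurable_restrict_prd] comp_def)
    qed
    moreover have "\<dots> = distr Omega_unif (induced_M (prd {0..n})) (\<lambda>\<omega>. dec {0..n} (?F \<omega>))"
      by (intro distr_cong) (simp_all add: G_def unif dec_truncate)
    ultimately show ?thesis by simp
  qed
  have "compose Omega QN \<alpha> \<in> adm (prob_qus (prd UNIV))" if \<alpha>: "\<alpha> \<in> adm Z" for \<alpha>
  proof -
    let ?Y = "\<lambda>\<omega>\<in>Omega. G (\<alpha> \<omega>)"
    let ?u = "\<lambda>(\<omega>, \<omega>')\<in>Omega \<times> Omega. ?Y \<omega> \<omega>'"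
    have "compose Omega ?u (\<lambda>\<omega>\<in>Omega. (\<beta> \<omega>, \<gamma> \<omega>)) \<in> adm (prd UNIV)"
      if \<beta>: "\<beta> \<in> Omega_maps" and \<gamma>: "\<gamma> \<in> Omega_maps" for \<beta> \<gamma>
    proof -
      have "(\<lambda>\<omega>\<in>Omega. dec UNIV (randomize (\<nu> (\<alpha> (\<beta> \<omega>))) (\<gamma> \<omega>))) \<in> adm (prd UNIV)"
        using \<beta> \<gamma> by (intro dec_adm joint \<alpha>) (auto simp: Omega_maps_def)
      also have "(\<lambda>\<omega>\<in>Omega. dec UNIV (randomize (\<nu> (\<alpha> (\<beta> \<omega>))) (\<gamma> \<omega>)))
          = compose Omega ?u (\<lambda>\<omega>\<in>Omega. (\<beta> \<omega>, \<gamma> \<omega>))"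
        using Omega_maps_D[OF \<beta>] Omega_maps_D[OF \<gamma>] by (auto simp: compose_def G_def fun_eq_iff)
      finally show ?thesis .
    qed
    moreover have "?u \<in> Omega \<times> Omega \<rightarrow>\<^sub>E pts (prd UNIV)"
      using adm_prd_pts[OF G_adm[OF Z_adm[OF \<alpha>]]] by auto
    ultimately have "?u \<in> quasi_measurable (pair_qus Omega_qus Omega_qus) (prd UNIV)"
      unfolding quasi_measurable_def pair_qus_def Omega_qus_def qus.simps by blast
    moreover have "?Y \<in> Omega \<rightarrow>\<^sub>E adm (prd UNIV)"
      using G_adm[OF Z_adm[OF \<alpha>]] by auto
    ultimately have "?Y \<in> adm_adm (prd UNIV)"
      unfolding adm_adm_def by blast
    moreover have "compose Omega QN \<alpha> = (\<lambda>\<omega>\<in>Omega. distr Omega_unif (induced_M (prd UNIV)) (?Y \<omega>))"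
      using Z_adm[OF \<alpha>] by (auto simp: compose_def QN_def)
    ultimately show ?thesis
      using Omega_unif_in_Omega_probs unfolding prob_qus_def qus.simps by blast
  qed
  moreover have "QN \<in> pts Z \<rightarrow>\<^sub>E pts (prob_qus (prd UNIV))"
    using QN_pts by (intro PiE_I) (auto simp: QN_def)
  ultimately have "QN \<in> quasi_measurable Z (prob_qus (prd UNIV))"
    unfolding quasi_measurable_def by blast
  with marginal show "\<exists>QN. QN \<in> quasi_measurable Z (prob_qus (prd UNIV)) \<and>
      (\<forall>n. \<forall>z\<in>pts Z. distr (QN z) (induced_M (prd {0..n})) (\<lambda>x. restrict x {0..n}) = Q n z)"
    by blast
next
  fix Q1 Q2
  assume *: "Q1 \<in> quasi_measurable Z (prob_qus (prd UNIV)) \<and>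
      (\<forall>n. \<forall>z\<in>pts Z. distr (Q1 z) (induced_M (prd {0..n})) (\<lambda>x. restrict x {0..n}) = Q n z)"
    "Q2 \<in> quasi_measurable Z (prob_qus (prd UNIV)) \<and>
      (\<forall>n. \<forall>z\<in>pts Z. distr (Q2 z) (induced_M (prd {0..n})) (\<lambda>x. restrict x {0..n}) = Q n z)"
  then have E: "Q1 \<in> pts Z \<rightarrow>\<^sub>E pts (prob_qus (prd UNIV))" "Q2 \<in> pts Z \<rightarrow>\<^sub>E pts (prob_qus (prd UNIV))"
    by (auto simp: quasi_measurable_def)
  show "Q1 = Q2"
  proof (rule PiE_ext[OF E])
    fix z assume z: "z \<in> pts Z"
    show "Q1 z = Q2 z"
    proof (rule marginals_unique)
      show "Q1 z \<in> pts (prob_qus (prd UNIV))" "Q2 z \<in> pts (prob_qus (prd UNIV))"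
        using PiE_mem[OF E(1) z] PiE_mem[OF E(2) z] .
      show "distr (Q1 z) (induced_M (prd {0..n})) (\<lambda>x. restrict x {0..n})
          = distr (Q2 z) (induced_M (prd {0..n})) (\<lambda>x. restrict x {0..n})" for n
        using * z by metis
    qed
  qed
qed

end

text \<open>With \<open>Z\<close> empty the factors may be empty as well, so retractions may be
  missing and this case stands apart. No map leads from the nonempty \<open>Omega\<close> into the
  empty set, so \<open>adm Z\<close> is empty and the everywhere undefined map is the only
  candidate.\<close>

lemma ex1_quasi_measurable_empty:
  assumes "quasi_universal_space Z" "pts Z = {}"
  shows "\<exists>!g. g \<in> quasi_measurable Z T"
proof -
  have "adm Z \<subseteq> Omega \<rightarrow>\<^sub>E {}"
    using assms by (simp add: quasi_universal_space_def)
  then have "adm Z = {}"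
    using zero_in_Omega by (auto simp: PiE_eq_empty_iff)
  then have "quasi_measurable Z T = {\<lambda>_. undefined}"
    by (simp add: quasi_measurable_def assms(2))
  then show ?thesis by simp
qed

theorem theorem7p31:
  fixes X :: "nat \<Rightarrow> 'a qus"
    and Z :: "'z qus"
    and Q :: "nat \<Rightarrow> 'z \<Rightarrow> (nat \<Rightarrow> 'a) measure"
  assumes "\<And>n. standard_qus (X n)"
    and "quasi_universal_space Z"
    and "\<And>n. Q n \<in> quasi_measurable Z (prob_qus (prod_qus {0..n} X))"
    and "\<And>n z. z \<in> pts Z \<Longrightarrow>
           distr (Q (Suc n) z) (induced_M (prod_qus {0..n} X)) (\<lambda>x. restrict x {0..n}) = Q n z"
  shows "\<exists>!QN. QN \<in> quasi_measurable Z (prob_qus (prod_qus UNIV X)) \<and>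
           (\<forall>n. \<forall>z\<in>pts Z.
              distr (QN z) (induced_M (prod_qus {0..n} X)) (\<lambda>x. restrict x {0..n}) = Q n z)"
proof (cases "pts Z = {}")
  case True
  then show ?thesis
    using ex1_quasi_measurable_empty[OF assms(2) True, of "prob_qus (prod_qus UNIV X)"] by simp
next
  case False
  then obtain z where z: "z \<in> pts Z" by blast
  have qus: "quasi_universal_space (X k)" for k
    using assms(1) by (simp add: standard_qus_def)
  \<comment> \<open>A point \<open>z\<close> yields the measure \<open>Q k z\<close>, which is by
    definition the law of some admissible \<open>Y\<close>; any value of \<open>Y\<close> has a
    \<open>k\<close>-th coordinate in \<open>X k\<close>. This rules out the empty case of
    standardness.\<close>
  have "pts (X k) \<noteq> {}" for k
  proof -
    have "Q k z \<in> pts (prob_qus (prod_qus {0..k} X))"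
      using assms(3)[of k] z by (auto simp: quasi_measurable_def)
    then obtain Y where "Y \<in> adm (prod_qus {0..k} X)"
      by (auto simp: prob_qus_def)
    then have "Y (\<lambda>_. 0) k \<in> pts (X k)"
      using zero_in_Omega by (fastforce simp: prod_qus_def)
    then show ?thesis by blast
  qed
  then have "\<forall>k. \<exists>i r. i \<in> quasi_measurable (X k) Omega_qus \<and> r \<in> quasi_measurable Omega_qus (X k) \<and>
      (\<forall>x\<in>pts (X k). r (i x) = x)"
    using assms(1) unfolding standard_qus_def by blast
  then obtain emb ret where *: "\<And>k. emb k \<in> quasi_measurable (X k) Omega_qus"
    "\<And>k. ret k \<in> quasi_measurable Omega_qus (X k)"
    "\<And>k x. x \<in> pts (X k) \<Longrightarrow> ret k (emb k x) = x"
    by metis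
  interpret retract_sequence X emb ret
    using qus * by unfold_locales
  show ?thesis
    using assms(2-4) by (rule ex1_projective_limit)
qed

end
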